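(* Let $n>2$ be prime and $\zeta$ a primitive $n$-th root of unity, and consider the family of polynomial systems with parameters $a$ described in the context. There is a Poincaré–Dulac normal form $\dot{\mathbf{y}}=\mathcal{Z}\mathbf{y}+\sum_{j\ge2}G_j(\mathbf{y})$ of this system, with $\mathcal{Z}=\mathrm{diag}[1,\zeta,\dots,\zeta^{n-1}]$ and each component of $G_j$ homogeneous of degree $j$ in $\mathbf{y}$, such that $G_j(\mathbf{y})=(y_1y_2\cdots y_n)^K\,(q_1(a)y_1,\dots,q_n(a)y_n)^\top$ with $q_i(a)\in R_{(K,\dots,K)}$ for $i=1,\dots,n$ (where $K$ and the $q_i$ depend on $j$, and the $q_i$ may be zero), and the polynomials $q_i(a)$ are elements of $\mathbb{Q}[H^{(n)}]$, the polynomial subalgebra generated by the set of monomials $\{[\nu]:\nu\in\mathcal{M}^{(n)}\}$.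
   Context: $\mathbb{N}_0=\{0,1,2,\dots\}$ and $\mathbb{N}_{-1}=\mathbb{N}_0\cup\{-1\}$. $T_n$ is the cyclic permutation $T_n(p_1,\dots,p_n)=(p_n,p_1,\dots,p_{n-1})$. Fix $\ell\ge1$ and distinct vectors $\mathbf{p}^{(1)},\dots,\mathbf{p}^{(\ell)}\in\mathbb{N}_{-1}\times\mathbb{N}_0^{n-1}$ with $\sum_jp_j^{(k)}\ge1$ for all $k$. For a vector $\mathbf{p}$ write $\mathbf{x}^{\mathbf{p}}=x_1^{p_1}\cdots x_n^{p_n}$. The system is $$\dot x_j=x_j\Big(\zeta^{j-1}+\sum_{k=1}^{\ell}a^{(j)}_{T_n^{j-1}(\mathbf{p}^{(k)})}\,\mathbf{x}^{T_n^{j-1}(\mathbf{p}^{(k)})}\Big),\qquad j=1,\dots,n,$$ with $n\ell$ parameters $a^{(j)}_{T_n^{j-1}(\mathbf{p}^{(k)})}$, regarded as independent variables of the polynomial ring $\mathbb{Q}[a]$. For $\nu\in\mathbb{N}_0^{n\ell}$: $[\nu]=\prod_{k=1}^{\ell}\prod_{m=0}^{n-1}\big(a^{(m+1)}_{T_n^m(\mathbf{p}^{(k)})}\big)^{\nu_{(k-1)n+m+1}}$ and $L(\nu)=\sum_{k=1}^{\ell}\sum_{m=0}^{n-1}\nu_{(k-1)n+m+1}\,T_n^m(\mathbf{p}^{(k)})\in\mathbb{Z}^n$. $\mathcal{M}^{(n)}=\{\nu\in\mathbb{N}_0^{n\ell}:L(\nu)=(K,\dots,K)\text{ for some }K\in\mathbb{N}_0\}$.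 For $m\in\mathbb{Z}^n$, $R_m$ is the set of polynomials in the parameters $a$ with rational coefficients, all of whose monomials $[\nu]$ (with nonzero coefficient) satisfy $L(\nu)=m$. $\mathbb{Q}[H^{(n)}]$ is the $\mathbb{Q}$-subalgebra of $\mathbb{Q}[a]$ generated by $\{[\nu]:\nu\in\mathcal{M}^{(n)}\}$. Normal form: a formal change of coordinates $\mathbf{x}=\mathbf{y}+\sum_{j\ge2}H_j(\mathbf{y})$, with each $H_j$ a vector of homogeneous polynomials of degree $j$, brings the system to the form $\dot{\mathbf{y}}=\mathcal{Z}\mathbf{y}+\sum_{j\ge2}G_j(\mathbf{y})$. The latter is a (Poincaré–Dulac) normal form of the system if every monomial $\mathbf{y}^\alpha$ ($\alpha\in\mathbb{N}_0^n$, $|\alpha|\ge2$) occurring with nonzero coefficient in the $k$-th component of $\sum_jG_j$ satisfies $\sum_{i=1}^n\alpha_i\zeta^{i-1}-\zeta^{k-1}=0$.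
   Formalization: The rational coefficients in R_(K,...,K) and the base field of Q[H^(n)] are replaced by Q(zeta): over Q the claim fails, e.g. n=3, p^(1)=(1,0,0), p^(2)=(0,1,1) forces q_2 = -zeta^(-1) a_2 b_2 in degree 4. *)

theory Defs
  imports
    "HOL-Library.Poly_Mapping"
    "HOL-Computational_Algebra.Formal_Power_Series"
    "HOL-Computational_Algebra.Primes"
    Complex_Main
begin

text \<open>
  Multivariate polynomials are finitely supported functions from exponent vectors to
  coefficients, with the ring structure of \<open>Poly_Mapping\<close>. All vectors are indexed
  from 1 to \<open>n\<close>.
\<close>

type_synonym ('v, 'c) mpoly = "('v \<Rightarrow>\<^sub>0 nat) \<Rightarrow>\<^sub>0 'c"

definition Var :: "'v \<Rightarrow> ('v, 'c::comm_ring_1) mpoly" where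
  "Var v = Poly_Mapping.single (Poly_Mapping.single v 1) 1"

definition Const :: "'c \<Rightarrow> ('v, 'c::comm_ring_1) mpoly" where
  "Const c = Poly_Mapping.single 0 c"

text \<open>
  The pair \<open>(k, j)\<close> names the parameter \<open>a\<close> with superscript \<open>(j)\<close> and subscript
  \<open>T^(j-1)\<close> applied to \<open>p^(k)\<close>. Hence the entry of \<open>\<nu>\<close> that the literature puts at the flat
  position \<open>(k-1)n+m+1\<close> is \<open>lookup \<nu> (k, m+1)\<close>.
\<close>

type_synonym param_exp = "(nat \<times> nat) \<Rightarrow>\<^sub>0 nat"
type_synonym param_poly = "(nat \<times> nat, complex) mpoly"

type_synonym state_poly = "(nat, param_poly) mpoly"

definition primitive_root_of_unity :: "nat \<Rightarrow> complex \<Rightarrow> bool" where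
  "primitive_root_of_unity n z \<longleftrightarrow> z ^ n = 1 \<and> (\<forall>m\<in>{1..<n}. z ^ m \<noteq> 1)"

definition T :: "nat \<Rightarrow> (nat \<Rightarrow> int) \<Rightarrow> (nat \<Rightarrow> int)" where
  "T n v = (\<lambda>i. if i = 1 then v n else v (i - 1))"

subsection \<open>The grading of the parameter ring\<close>

definition param_exps :: "nat \<Rightarrow> nat \<Rightarrow> param_exp set" where
  "param_exps n l = {\<nu>. Poly_Mapping.keys \<nu> \<subseteq> {1..l} \<times> {1..n}}"

definition param_monom :: "nat \<Rightarrow> nat \<Rightarrow> param_exp \<Rightarrow> param_poly" where
  "param_monom n l \<nu> = (\<Prod>k=1..l. \<Prod>m<n. Var (k, m + 1) ^ Poly_Mapping.lookup \<nu> (k, m + 1))"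

definition L :: "nat \<Rightarrow> nat \<Rightarrow> (nat \<Rightarrow> nat \<Rightarrow> int) \<Rightarrow> param_exp \<Rightarrow> nat \<Rightarrow> int" where
  "L n l p \<nu> i = (\<Sum>k=1..l. \<Sum>m<n. int (Poly_Mapping.lookup \<nu> (k, m + 1)) * (T n ^^ m) (p k) i)"

definition M :: "nat \<Rightarrow> nat \<Rightarrow> (nat \<Rightarrow> nat \<Rightarrow> int) \<Rightarrow> param_exp set" where
  "M n l p = {\<nu> \<in> param_exps n l. \<exists>K::nat. \<forall>i\<in>{1..n}. L n l p \<nu> i = int K}"

text \<open>\<open>F\<close> is the field of coefficients.\<close>

definition R ::
  "complex set \<Rightarrow> nat \<Rightarrow> nat \<Rightarrow> (nat \<Rightarrow> nat \<Rightarrow> int) \<Rightarrow> (nat \<Rightarrow> int) \<Rightarrow> param_poly set" where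
  "R F n l p m = {f. \<forall>\<nu>\<in>Poly_Mapping.keys f.
      Poly_Mapping.lookup f \<nu> \<in> F \<and> \<nu> \<in> param_exps n l \<and> (\<forall>i\<in>{1..n}. L n l p \<nu> i = m i)}"

inductive_set subalgebra_gen :: "complex set \<Rightarrow> param_poly set \<Rightarrow> param_poly set"
  for F :: "complex set" and S :: "param_poly set" where
  scalar: "c \<in> F \<Longrightarrow> Const c \<in> subalgebra_gen F S"
| gen: "f \<in> S \<Longrightarrow> f \<in> subalgebra_gen F S"
| plus: "f \<in> subalgebra_gen F S \<Longrightarrow> g \<in> subalgebra_gen F S \<Longrightarrow> f + g \<in> subalgebra_gen F S"
| times: "f \<in> subalgebra_gen F S \<Longrightarrow> g \<in> subalgebra_gen F S \<Longrightarrow> f * g \<in> subalgebra_gen F S"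

text \<open>
  The smallest subfield of the complex numbers containing \<open>z\<close>. The coefficients of a normal
  form have to be taken in \<open>\<rat>(\<zeta>)\<close> (\<open>\<rat>\<close>, as one finds it in print, does not suffice), since the denominators in the homological
  equation are nonzero elements of \<open>\<int>[\<zeta>]\<close>. Already for \<open>n = 3\<close>, \<open>p^(1) = (1,0,0)\<close>,
  \<open>p^(2) = (0,1,1)\<close>, i.e. for the system
  \<open>x\<^sub>j' = x\<^sub>j (\<zeta>^(j-1) + a\<^sub>j x\<^sub>j + b\<^sub>j x\<^sub>1x\<^sub>2x\<^sub>3/x\<^sub>j)\<close>, every normal form has the term
  \<open>- \<zeta>^(-1) a\<^sub>2b\<^sub>2 y\<^sub>1y\<^sub>2y\<^sub>3 y\<^sub>2\<close> in its second component.
\<close>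

definition rat_adjoin :: "complex \<Rightarrow> complex set" where
  "rat_adjoin z = \<Inter> {F. \<rat> \<subseteq> F \<and> z \<in> F \<and>
     (\<forall>x\<in>F. \<forall>y\<in>F. x - y \<in> F \<and> x * y \<in> F) \<and> (\<forall>x\<in>F. inverse x \<in> F)}"

subsection \<open>The system and its formal transformations\<close>

text \<open>
  Component \<open>j\<close> of the right-hand side. In the product the exponent of \<open>x\<^sub>j\<close> is
  1 plus the \<open>j\<close>-th entry of \<open>T^(j-1)\<close> \<open>p^(k)\<close>, which is the first entry of \<open>p^(k)\<close> and
  thus at least \<open>-1\<close>; so \<open>nat\<close> truncates nothing.
\<close>

definition system_rhs ::
  "nat \<Rightarrow> nat \<Rightarrow> complex \<Rightarrow> (nat \<Rightarrow> nat \<Rightarrow> int) \<Rightarrow> nat \<Rightarrow> state_poly" where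
  "system_rhs n l \<zeta> p j = Const (Const (\<zeta> ^ (j - 1))) * Var j +
     (\<Sum>k=1..l. Const (Var (k, j)) *
        (\<Prod>i=1..n. Var i ^ nat ((T n ^^ (j - 1)) (p k) i + (if i = j then 1 else 0))))"

text \<open>Homogeneous of degree \<open>d\<close> in the states 1 to \<open>n\<close>, polynomial in the parameters.\<close>

definition homogeneous :: "nat \<Rightarrow> nat \<Rightarrow> nat \<Rightarrow> state_poly \<Rightarrow> bool" where
  "homogeneous n l d f \<longleftrightarrow> (\<forall>\<alpha>\<in>Poly_Mapping.keys f.
     Poly_Mapping.keys \<alpha> \<subseteq> {1..n} \<and> (\<Sum>i=1..n. Poly_Mapping.lookup \<alpha> i) = d \<and>
     Poly_Mapping.keys (Poly_Mapping.lookup f \<alpha>) \<subseteq> param_exps n l)"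

text \<open>
  A formal power series in \<open>y\<close> is encoded by its expansion into homogeneous polynomials,
  as the univariate series whose \<open>d\<close>-th coefficient is the part of degree \<open>d\<close>. Sums
  and products of such series are then those of the type \<open>fps\<close>.
\<close>

definition expansion :: "state_poly \<Rightarrow> (nat \<Rightarrow> state_poly) \<Rightarrow> state_poly fps" where
  "expansion f H = Abs_fps (\<lambda>d. if d = 0 then 0 else if d = 1 then f else H d)"

definition subst :: "nat \<Rightarrow> (nat \<Rightarrow> state_poly fps) \<Rightarrow> state_poly \<Rightarrow> state_poly fps" where
  "subst n \<Phi> f = (\<Sum>\<alpha>\<in>Poly_Mapping.keys f.
     fps_const (Const (Poly_Mapping.lookup f \<alpha>)) * (\<Prod>i=1..n. \<Phi> i ^ Poly_Mapping.lookup \<alpha> i))"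

definition partial :: "nat \<Rightarrow> state_poly \<Rightarrow> state_poly" where
  "partial i f = (\<Sum>\<alpha>\<in>Poly_Mapping.keys f.
     Poly_Mapping.single (\<alpha> - Poly_Mapping.single i 1)
       (of_nat (Poly_Mapping.lookup \<alpha> i) * Poly_Mapping.lookup f \<alpha>))"

text \<open>Differentiation lowers the degree by one, hence the shift.\<close>

definition partial_fps :: "nat \<Rightarrow> state_poly fps \<Rightarrow> state_poly fps" where
  "partial_fps i f = Abs_fps (\<lambda>d. partial i (fps_nth f (d + 1)))"

text \<open>
  \<open>H d i\<close> and \<open>G d i\<close> are the \<open>i\<close>-th components of \<open>H\<^sub>d\<close> and \<open>G\<^sub>d\<close>; only \<open>d \<ge> 2\<close> and
  \<open>1 \<le> i \<le> n\<close> matter.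
\<close>

definition transformation :: "(nat \<Rightarrow> nat \<Rightarrow> state_poly) \<Rightarrow> nat \<Rightarrow> state_poly fps" where
  "transformation H i = expansion (Var i) (\<lambda>d. H d i)"

definition transformed_rhs ::
  "complex \<Rightarrow> (nat \<Rightarrow> nat \<Rightarrow> state_poly) \<Rightarrow> nat \<Rightarrow> state_poly fps" where
  "transformed_rhs \<zeta> G i = expansion (Const (Const (\<zeta> ^ (i - 1))) * Var i) (\<lambda>d. G d i)"

text \<open>
  With \<open>x = \<Phi>(y)\<close>, the system \<open>x' = f(x)\<close> becomes \<open>y' = g(y)\<close> iff \<open>D\<Phi>(y) g(y) = f(\<Phi>(y))\<close>.
\<close>

definition brings_to ::
  "nat \<Rightarrow> nat \<Rightarrow> complex \<Rightarrow> (nat \<Rightarrow> nat \<Rightarrow> int) \<Rightarrow>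
    (nat \<Rightarrow> nat \<Rightarrow> state_poly) \<Rightarrow> (nat \<Rightarrow> nat \<Rightarrow> state_poly) \<Rightarrow> bool" where
  "brings_to n l \<zeta> p H G \<longleftrightarrow> (\<forall>j\<in>{1..n}.
     (\<Sum>i=1..n. partial_fps i (transformation H j) * transformed_rhs \<zeta> G i) =
     subst n (transformation H) (system_rhs n l \<zeta> p j))"

definition poincare_dulac_normal_form ::
  "nat \<Rightarrow> nat \<Rightarrow> complex \<Rightarrow> (nat \<Rightarrow> nat \<Rightarrow> int) \<Rightarrow>
    (nat \<Rightarrow> nat \<Rightarrow> state_poly) \<Rightarrow> (nat \<Rightarrow> nat \<Rightarrow> state_poly) \<Rightarrow> bool" where
  "poincare_dulac_normal_form n l \<zeta> p H G \<longleftrightarrow>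
     (\<forall>d\<ge>2. \<forall>i\<in>{1..n}. homogeneous n l d (H d i) \<and> homogeneous n l d (G d i)) \<and>
     brings_to n l \<zeta> p H G \<and>
     (\<forall>d\<ge>2. \<forall>k\<in>{1..n}. \<forall>\<alpha>\<in>Poly_Mapping.keys (G d k).
        (\<Sum>i=1..n. of_nat (Poly_Mapping.lookup \<alpha> i) * \<zeta> ^ (i - 1)) - \<zeta> ^ (k - 1) = 0)"

end

theory Submission
  imports Defs "HOL-Computational_Algebra.Polynomial_Factorial"
begin

text \<open>
  Comparing coefficients of degree \<open>d\<close> in \<open>D\<Phi>(y) g(y) = f(\<Phi>(y))\<close> gives, for the coefficient
  of \<open>y^\<alpha>\<close> in component \<open>j\<close>, the homological equation
  \<open>(\<lambda>\<^sub>\<alpha> - \<zeta>^(j-1)) H + G = N\<close>. Here \<open>\<lambda>\<^sub>\<alpha> = \<Sum>\<^sub>i \<alpha>\<^sub>i \<zeta>^(i-1)\<close>, and \<open>N\<close> is determined by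
  the parts of \<open>H\<close> and \<open>G\<close> of degree below \<open>d\<close>, because all terms of the system other than the
  linear one have degree at least 2. Dividing by \<open>\<lambda>\<^sub>\<alpha> - \<zeta>^(j-1)\<close> where it is nonzero and
  putting \<open>G = N\<close> where it vanishes produces a normal form, degree by degree. Its special shape
  has two independent reasons.

  The first one is arithmetic. For prime \<open>n\<close> the \<open>n\<close>-th cyclotomic polynomial is irreducible
  (Eisenstein's criterion after the shift \<open>x \<mapsto> x + 1\<close>), so
  \<open>1 + \<zeta> + \<dots> + \<zeta>^(n-1) = 0\<close> is up to scaling the only integer relation between the powers of
  \<open>\<zeta>\<close> (\<open>integer_relation_root_of_unity\<close>). Hence \<open>\<lambda>\<^sub>\<alpha> = \<zeta>^(j-1)\<close> forces
  \<open>y^\<alpha> = (y\<^sub>1 \<cdots> y\<^sub>n)^K y\<^sub>j\<close>, and \<open>K\<close> is determined by the degree \<open>nK + 1\<close>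
  (\<open>resonance\<close>, \<open>nf_G_shape\<close>).

  The second one is a grading. Give the monomial \<open>[\<nu>] y^\<alpha>\<close> the weight \<open>\<alpha> - L(\<nu>)\<close>. Weights add
  under multiplication, and differentiation with respect to \<open>y\<^sub>i\<close> lowers them by the unit vector
  \<open>e\<^sub>i\<close>. By the definition of \<open>L\<close>, all monomials of the \<open>j\<close>-th component of the system have
  weight \<open>e\<^sub>j\<close>. Every operation of the recursion respects this, so the \<open>j\<close>-th components of
  \<open>H\<close> and \<open>G\<close> have weight \<open>e\<^sub>j\<close> too (\<open>nf_grade\<close>). For the monomial
  \<open>(y\<^sub>1 \<cdots> y\<^sub>n)^K y\<^sub>j\<close> this says that its coefficient consists of monomials \<open>[\<nu>]\<close> with
  \<open>L(\<nu>) = (K,\<dots>,K)\<close>. These \<open>\<nu>\<close> lie in \<open>M\<close>, whence the coefficient is in the subalgebra.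
\<close>

section \<open>Integer relations between roots of unity of prime order\<close>

definition ipoly :: "int poly \<Rightarrow> complex \<Rightarrow> complex" where
  "ipoly f z = poly (map_poly of_int f) z"

lemma ipoly_add: "ipoly (f + g) z = ipoly f z + ipoly g z"
proof -
  have "map_poly of_int (f + g) = map_poly of_int f + (map_poly of_int g :: complex poly)"
    by (rule poly_eqI) (simp add: coeff_map_poly)
  then show ?thesis by (simp add: ipoly_def)
qed

lemma ipoly_mult: "ipoly (f * g) z = ipoly f z * ipoly g z"
proof -
  have "map_poly of_int (f * g) = map_poly of_int f * (map_poly of_int g :: complex poly)"
    by (rule poly_eqI) (simp add: coeff_map_poly coeff_mult)
  then show ?thesis by (simp add: ipoly_def)
qed

lemma ipoly_0: "ipoly 0 z = 0"
  by (simp add: ipoly_def)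

lemma ipoly_sum: "ipoly (\<Sum>i\<in>I. f i) z = (\<Sum>i\<in>I. ipoly (f i) z)"
  by (induction I rule: infinite_finite_induct) (simp_all add: ipoly_add ipoly_0)

lemma ipoly_pCons: "ipoly (pCons a f) z = of_int a + z * ipoly f z"
  by (simp add: ipoly_def map_poly_pCons)

lemma ipoly_monom: "ipoly (monom a i) z = of_int a * z ^ i"
  by (simp add: ipoly_def map_poly_monom poly_monom)

lemma ipoly_smult: "ipoly (smult a f) z = of_int a * ipoly f z"
  by (simp add: ipoly_def map_poly_smult)

lemmas ipoly_simps = ipoly_0 ipoly_add ipoly_mult ipoly_sum ipoly_pCons ipoly_monom ipoly_smult

text \<open>
  The heart of Eisenstein's criterion: at the first coefficient of \<open>b\<close> not divisible by \<open>q\<close>,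
  all but one term of the convolution for \<open>a * b\<close> are divisible by \<open>q\<close>.
\<close>
lemma Eisenstein_factor:
  fixes a b :: "int poly" and q :: int
  assumes "prime q" and low: "\<forall>i<degree (a * b). q dvd coeff (a * b) i"
    and "\<not> q dvd coeff a 0" and "\<not> q dvd lead_coeff b" and "degree b < degree (a * b)"
  shows False
proof -
  define i where "i = (LEAST i. \<not> q dvd coeff b i)"
  have ni: "\<not> q dvd coeff b i"
    unfolding i_def by (rule LeastI) (rule assms(4))
  have less: "q dvd coeff b j" if "j < i" for j
    using not_less_Least[of j "\<lambda>i. \<not> q dvd coeff b i"] that by (auto simp: i_def)
  have "i \<le> degree b"
    unfolding i_def by (rule Least_le) (rule assms(4))
  then have "q dvd coeff (a * b) i"
    using low assms(5) by auto
  moreover have "coeff (a * b) i = coeff a 0 * coeff b i + (\<Sum>j\<in>{1..i}. coeff a j * coeff b (i - j))"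
    by (simp add: coeff_mult sum.atLeast_Suc_atMost atMost_atLeast0)
  moreover have "q dvd (\<Sum>j\<in>{1..i}. coeff a j * coeff b (i - j))"
    by (intro dvd_sum dvd_mult less) auto
  ultimately have "q dvd coeff a 0 * coeff b i"
    by (simp add: dvd_add_left_iff)
  then show False
    using ni assms(1,3) by (simp add: prime_dvd_mult_iff)
qed

lemma Eisenstein_irreducible:
  fixes f :: "int poly" and q :: int
  assumes "prime q" and "degree f > 0" and monic: "lead_coeff f = 1"
    and low: "\<forall>i<degree f. q dvd coeff f i" and "\<not> q\<^sup>2 dvd coeff f 0"
  shows "irreducible f"
proof (rule irreducibleI)
  show "f \<noteq> 0" using assms(2) by auto
  show "\<not> f dvd 1"
    using assms(2) by (metis is_unit_polyE degree_pCons_0 less_irrefl)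
  fix a b assume f: "f = a * b"
  have lc: "lead_coeff a * lead_coeff b = 1"
    using monic by (simp add: f lead_coeff_mult)
  then have units: "is_unit (lead_coeff a)" "is_unit (lead_coeff b)"
    by (metis dvd_triv_left, metis dvd_triv_right)
  then have nd: "\<not> q dvd lead_coeff a" "\<not> q dvd lead_coeff b"
    using assms(1) dvd_unit_imp_unit not_prime_unit by blast+
  have nz: "a \<noteq> 0" "b \<noteq> 0"
    using lc by auto
  have deg: "degree f = degree a + degree b"
    using nz by (simp add: f degree_mult_eq)
  have const: "is_unit c" if "degree c = 0" "is_unit (lead_coeff c)" for c :: "int poly"
    using that by (auto elim!: degree_eq_zeroE simp: is_unit_const_poly_iff)
  show "is_unit a \<or> is_unit b"
  proof (rule ccontr)
    assume "\<not> ?thesis"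
    then have pos: "degree a > 0" "degree b > 0"
      using const[of a] const[of b] units by (metis not_gr_zero)+
    have "q dvd coeff a 0 * coeff b 0 \<and> \<not> q * q dvd coeff a 0 * coeff b 0"
      using low assms(2,5) by (auto simp: f coeff_mult_0 power2_eq_square)
    then consider "\<not> q dvd coeff a 0" | "\<not> q dvd coeff b 0"
      by (auto intro: mult_dvd_mono)
    then show False
    proof cases
      case 1
      then show False
        using Eisenstein_factor[of q a b] assms(1) low nd deg pos by (auto simp: f)
    next
      case 2
      then show False
        using Eisenstein_factor[of q b a] assms(1) low nd deg pos by (auto simp: f mult.commute)
    qed
  qed
qed

text \<open>
  If \<open>b\<close> has least degree among the nonzero integer polynomials vanishing at \<open>z\<close>, then
  pseudo-division shows that \<open>b\<close> divides \<open>c f\<close> for some nonzero integer \<open>c\<close>. As \<open>f\<close> is prime in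
  the factorial ring of integer polynomials, it divides \<open>b\<close>, or else \<open>b\<close> divides \<open>c\<close>.
\<close>
lemma root_of_irreducible_int_poly:
  fixes f g :: "int poly" and z :: complex
  assumes "irreducible f" and "ipoly f z = 0"
    and "ipoly g z = 0" and "degree g < degree f"
  shows "g = 0"
proof (rule ccontr)
  assume "g \<noteq> 0"
  define P where "P = (\<lambda>h::int poly. h \<noteq> 0 \<and> ipoly h z = 0)"
  obtain b where b: "P b" and min: "\<And>h. P h \<Longrightarrow> degree b \<le> degree h"
    using ex_has_least_nat[of P g degree] \<open>g \<noteq> 0\<close> assms(3) by (auto simp: P_def)
  obtain c u where c: "c \<noteq> 0" and eq: "smult c f = b * u + pseudo_mod f b"
    and r: "pseudo_mod f b = 0 \<or> degree (pseudo_mod f b) < degree b"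
    using pseudo_mod[of b f] b unfolding P_def by blast
  have "ipoly (smult c f) z = ipoly (b * u + pseudo_mod f b) z"
    by (simp only: eq)
  then have "ipoly (pseudo_mod f b) z = 0"
    using b assms(2) by (simp add: P_def ipoly_simps)
  then have "pseudo_mod f b = 0"
    using min[of "pseudo_mod f b"] r by (fastforce simp: P_def)
  with eq have bu: "b * u = smult c f" by simp
  have "prime_elem f"
    using assms(1) by (rule irreducible_imp_prime_elem)
  moreover have "f dvd b * u"
    unfolding bu by (rule dvd_smult) simp
  ultimately consider "f dvd b" | "f dvd u"
    by (auto simp: prime_elem_dvd_mult_iff)
  then show False
  proof cases
    case 1
    then have "degree f \<le> degree b"
      using b by (auto simp: P_def intro: dvd_imp_degree_le)
    also have "\<dots> \<le> degree g"
      using min \<open>g \<noteq> 0\<close> assms(3) by (auto simp: P_def)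
    finally show False using assms(4) by simp
  next
    case 2
    then obtain v where v: "u = f * v" by auto
    have "f * (b * v) = f * [:c:]"
      using bu by (simp add: v ac_simps)
    then have "b * v = [:c:]"
      using prime_elem_not_zeroI[OF \<open>prime_elem f\<close>] by (metis mult_left_cancel)
    moreover from this c have "b \<noteq> 0" "v \<noteq> 0" by auto
    ultimately have "degree b = 0"
      by (metis degree_mult_eq degree_pCons_0 add_is_0)
    then obtain e where "b = [:e:]" by (rule degree_eq_zeroE)
    with b show False by (auto simp: P_def ipoly_simps)
  qed
qed

text \<open>
  The polynomial \<open>f\<close> is \<open>((x + 1)^n - 1) / x\<close>, that is, the \<open>n\<close>-th cyclotomic polynomial at
  \<open>x + 1\<close>. After this shift, its coefficients are the binomial coefficients to which
  Eisenstein's criterion applies.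
\<close>
lemma shifted_cyclotomic_irreducible:
  fixes n :: nat
  assumes "prime n"
  defines "f \<equiv> (\<Sum>i<n. monom (int (n choose (i + 1))) i)"
  shows "irreducible f" and "degree f = n - 1"
    and "z ^ n = 1 \<Longrightarrow> z \<noteq> 1 \<Longrightarrow> ipoly f (z - 1) = (0::complex)"
proof -
  have n: "n > 1" using assms(1) by (rule prime_gt_1_nat)
  have co: "coeff f i = (if i < n then int (n choose (i + 1)) else 0)" for i
    by (simp add: f_def coeff_sum)
  show deg: "degree f = n - 1"
  proof (rule antisym)
    show "degree f \<le> n - 1" by (rule degree_le) (auto simp: co)
    show "n - 1 \<le> degree f" using n by (intro le_degree) (auto simp: co)
  qed
  show "irreducible f"
  proof (rule Eisenstein_irreducible[of "int n"])
    show "prime (int n)" using assms(1) by simp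
    show "0 < degree f" using n deg by simp
    show "lead_coeff f = 1" using n by (simp add: deg co)
    show "\<forall>i<degree f. int n dvd coeff f i"
    proof (intro allI impI)
      fix i assume "i < degree f"
      then have "n dvd (n choose (i + 1))"
        using n deg assms(1) by (intro dvd_choose_prime) auto
      then show "int n dvd coeff f i"
        using \<open>i < degree f\<close> deg by (simp add: co)
    qed
    show "\<not> (int n)\<^sup>2 dvd coeff f 0"
      using n by (auto simp: co power2_eq_square dest!: zdvd_imp_le)
  qed
  assume z: "z ^ n = 1" "z \<noteq> 1"
  have "(z - 1) * ipoly f (z - 1) =
      (\<Sum>i<n. of_nat (n choose (i + 1)) * (z - 1) ^ (i + 1))"
    by (simp add: f_def ipoly_simps sum_distrib_left ac_simps)
  also have "\<dots> = (\<Sum>i\<in>{1..n}. of_nat (n choose i) * (z - 1) ^ i)"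
    by (rule sum.reindex_bij_witness[of _ "\<lambda>i. i - 1" "\<lambda>i. i + 1"]) auto
  also have "\<dots> = (\<Sum>i\<le>n. of_nat (n choose i) * (z - 1) ^ i) - 1"
    by (simp add: atMost_atLeast0 sum.atLeast_Suc_atMost)
  also have "\<dots> = ((z - 1) + 1) ^ n - 1"
    by (simp only: binomial_ring) simp
  finally show "ipoly f (z - 1) = 0"
    using z by simp
qed

text \<open>
  Subtracting \<open>a (n - 1)\<close> times the relation \<open>1 + z + \<dots> + z^(n-1) = 0\<close> leaves a relation of degree
  at most \<open>n - 2\<close>, below the degree of the irreducible polynomial of \<open>z - 1\<close>; it must be trivial.
\<close>
lemma integer_relation_root_of_unity:
  fixes z :: complex and a :: "nat \<Rightarrow> int"
  assumes "prime n" and "z ^ n = 1" and "z \<noteq> 1"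
    and rel: "(\<Sum>i<n. of_int (a i) * z ^ i) = 0" and "i < n"
  shows "a i = a (n - 1)"
proof -
  define g where "g = (\<Sum>i<n. monom (a i - a (n - 1)) i)"
  have n: "n > 1" using assms(1) by (rule prime_gt_1_nat)
  have co: "coeff g i = (if i < n then a i - a (n - 1) else 0)" for i
    by (simp add: g_def coeff_sum)
  have "degree g \<le> n - 2"
  proof (rule degree_le, intro allI impI)
    fix j assume "n - 2 < j"
    then have "j = n - 1 \<or> j \<ge> n" by linarith
    then show "coeff g j = 0" by (auto simp: co)
  qed
  then have deg: "degree (pcompose g [:1, 1:]) < n - 1"
    using n by (simp add: degree_pcompose)
  have "(\<Sum>i<n. z ^ i) = 0"
    using assms(2,3) by (simp add: sum_gp_strict)
  moreover have "ipoly g z =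
      (\<Sum>i<n. of_int (a i) * z ^ i) - of_int (a (n - 1)) * (\<Sum>i<n. z ^ i)"
    by (simp add: g_def ipoly_simps sum_distrib_left sum_distrib_right algebra_simps sum_subtractf)
  ultimately have "ipoly g z = 0"
    using rel by simp
  moreover have "ipoly (pcompose h [:1, 1:]) w = ipoly h (w + 1)"
    for h and w :: complex
    by (induction h) (simp_all add: pcompose_pCons ipoly_simps algebra_simps)
  ultimately have "pcompose g [:1, 1:] = 0"
    using root_of_irreducible_int_poly[OF shifted_cyclotomic_irreducible(1)[OF assms(1)]
        shifted_cyclotomic_irreducible(3)[OF assms(1-3)]] deg
      shifted_cyclotomic_irreducible(2)[OF assms(1)] by simp
  then have "g = 0" by (rule pcompose_eq_0) simp
  then have "coeff g i = 0" by simp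
  with assms(5) show ?thesis by (simp add: co)
qed

section \<open>Polynomials with prescribed sets of coefficients\<close>

text \<open>
  The grading of the parameter ring and that of the state polynomials over it both arise in this
  form: a homogeneous component prescribes for each exponent \<open>k\<close> an additive group \<open>A k\<close> of
  admissible coefficients, which is \<open>{0}\<close> if the exponent has the wrong weight.
\<close>
definition coeffs_in :: "('k \<Rightarrow> 'c set) \<Rightarrow> ('k \<Rightarrow>\<^sub>0 'c::zero) set" where
  "coeffs_in A = {f. \<forall>k. Poly_Mapping.lookup f k \<in> A k}"

lemma sum_singles:
  "(\<Sum>k\<in>Poly_Mapping.keys f. Poly_Mapping.single k (Poly_Mapping.lookup f k)) = f"
  by (rule poly_mapping_eqI) (simp add: lookup_sum lookup_single when_def in_keys_iff)

lemma single_in_coeffs_in: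
  assumes "\<And>k. 0 \<in> A k" and "c \<in> A k"
  shows "Poly_Mapping.single k c \<in> coeffs_in A"
  using assms by (auto simp: coeffs_in_def lookup_single when_def)

lemma coeffs_in_sum:
  fixes f :: "'i \<Rightarrow> 'k \<Rightarrow>\<^sub>0 'c::comm_monoid_add"
  assumes "\<And>k. 0 \<in> A k" and "\<And>k x y. x \<in> A k \<Longrightarrow> y \<in> A k \<Longrightarrow> x + y \<in> A k"
    and "\<And>i. i \<in> I \<Longrightarrow> f i \<in> coeffs_in A"
  shows "(\<Sum>i\<in>I. f i) \<in> coeffs_in A"
  using assms(3)
  by (induction I rule: infinite_finite_induct)
    (use assms(1,2) in \<open>simp_all add: coeffs_in_def lookup_add\<close>)

lemma coeffs_in_mult:
  fixes f g :: "'k::monoid_add \<Rightarrow>\<^sub>0 'c::semiring_0"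
  assumes "f \<in> coeffs_in A" and "g \<in> coeffs_in B"
    and "\<And>k. 0 \<in> C k" and "\<And>k x y. x \<in> C k \<Longrightarrow> y \<in> C k \<Longrightarrow> x + y \<in> C k"
    and mult: "\<And>k l x y. x \<in> A k \<Longrightarrow> y \<in> B l \<Longrightarrow> x * y \<in> C (k + l)"
  shows "f * g \<in> coeffs_in C"
proof -
  have "f * g = (\<Sum>k\<in>Poly_Mapping.keys f. \<Sum>l\<in>Poly_Mapping.keys g.
      Poly_Mapping.single (k + l) (Poly_Mapping.lookup f k * Poly_Mapping.lookup g l))"
    by (subst (1 2) sum_singles[symmetric]) (simp only: sum_product mult_single)
  also have "\<dots> \<in> coeffs_in C"
  proof (intro coeffs_in_sum single_in_coeffs_in mult assms(3,4))
    show "Poly_Mapping.lookup f k \<in> A k" "Poly_Mapping.lookup g k \<in> B k" for k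
      using assms(1,2) by (auto simp: coeffs_in_def)
  qed
  finally show ?thesis .
qed

section \<open>The coefficient field\<close>

lemma rat_adjoin_field:
  assumes "x \<in> rat_adjoin z" "y \<in> rat_adjoin z"
  shows "x - y \<in> rat_adjoin z" "x * y \<in> rat_adjoin z"
  using assms unfolding rat_adjoin_def by blast+

lemma rat_adjoin_inverse: "x \<in> rat_adjoin z \<Longrightarrow> inverse x \<in> rat_adjoin z"
  unfolding rat_adjoin_def by blast

lemma rat_adjoin_base: "z \<in> rat_adjoin z" "q \<in> \<rat> \<Longrightarrow> q \<in> rat_adjoin z"
  unfolding rat_adjoin_def by blast+

lemma rat_adjoin_const: "0 \<in> rat_adjoin z" "1 \<in> rat_adjoin z" "of_nat m \<in> rat_adjoin z"
  by (rule rat_adjoin_base; simp)+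

lemma rat_adjoin_uminus: "x \<in> rat_adjoin z \<Longrightarrow> - x \<in> rat_adjoin z"
  using rat_adjoin_field(1)[of 0 z x] rat_adjoin_const by simp

lemma rat_adjoin_add: "x \<in> rat_adjoin z \<Longrightarrow> y \<in> rat_adjoin z \<Longrightarrow> x + y \<in> rat_adjoin z"
  using rat_adjoin_field(1)[of x z "- y"] rat_adjoin_uminus by simp

lemma rat_adjoin_sum: "(\<And>i. i \<in> I \<Longrightarrow> f i \<in> rat_adjoin z) \<Longrightarrow> sum f I \<in> rat_adjoin z"
  by (induction I rule: infinite_finite_induct) (simp_all add: rat_adjoin_const rat_adjoin_add)

lemma rat_adjoin_power: "x \<in> rat_adjoin z \<Longrightarrow> x ^ k \<in> rat_adjoin z"
  by (induction k) (simp_all add: rat_adjoin_const rat_adjoin_field)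

section \<open>The weight grading\<close>

lemma L_zero [simp]: "L n l p 0 i = 0"
  by (simp add: L_def)

lemma L_add: "L n l p (\<mu> + \<nu>) i = L n l p \<mu> i + L n l p \<nu> i"
  by (simp add: L_def lookup_add sum.distrib algebra_simps)

lemma L_single:
  assumes "k \<in> {1..l}" and "j \<in> {1..n}"
  shows "L n l p (Poly_Mapping.single (k, j) 1) i = (T n ^^ (j - 1)) (p k) i"
proof -
  have "L n l p (Poly_Mapping.single (k, j) 1) i =
      (\<Sum>k'=1..l. if k' = k then \<Sum>m<n. if m = j - 1 then (T n ^^ m) (p k) i else 0 else 0)"
    unfolding L_def
  proof (rule sum.cong)
    fix k'
    have "int (Poly_Mapping.lookup (Poly_Mapping.single (k, j) 1) (k', m + 1)) * (T n ^^ m) (p k') i =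
        (if k' = k then if m = j - 1 then (T n ^^ m) (p k) i else 0 else 0)" for m
      using assms(2) by (auto simp: lookup_single when_def)
    then show "(\<Sum>m<n. int (Poly_Mapping.lookup (Poly_Mapping.single (k, j) 1) (k', m + 1)) * (T n ^^ m) (p k') i)
        = (if k' = k then \<Sum>m<n. if m = j - 1 then (T n ^^ m) (p k) i else 0 else 0)"
      by (simp only:) simp
  qed simp
  then show ?thesis using assms by auto
qed

lemma param_exps_zero [simp]: "0 \<in> param_exps n l"
  by (simp add: param_exps_def)

lemma param_exps_add: "\<mu> \<in> param_exps n l \<Longrightarrow> \<nu> \<in> param_exps n l \<Longrightarrow> \<mu> + \<nu> \<in> param_exps n l"
  using keys_add[of \<mu> \<nu>] by (auto simp: param_exps_def)

locale cyclic_grading =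
  fixes n l :: nat and \<zeta> :: complex and p :: "nat \<Rightarrow> nat \<Rightarrow> int"
begin

abbreviation "pgrade \<equiv> R (rat_adjoin \<zeta>) n l p"

definition pcoeffs :: "(nat \<Rightarrow> int) \<Rightarrow> param_exp \<Rightarrow> complex set" where
  "pcoeffs m \<nu> =
     (if \<nu> \<in> param_exps n l \<and> (\<forall>i\<in>{1..n}. L n l p \<nu> i = m i) then rat_adjoin \<zeta> else {0})"

lemma pcoeffs_zero [simp]: "0 \<in> pcoeffs m \<nu>"
  by (simp add: pcoeffs_def rat_adjoin_const)

lemma pcoeffs_add: "x \<in> pcoeffs m \<nu> \<Longrightarrow> y \<in> pcoeffs m \<nu> \<Longrightarrow> x + y \<in> pcoeffs m \<nu>"
  unfolding pcoeffs_def by (split if_split_asm)+ (simp_all add: rat_adjoin_add)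

lemma pcoeffs_uminus: "x \<in> pcoeffs m \<nu> \<Longrightarrow> - x \<in> pcoeffs m \<nu>"
  unfolding pcoeffs_def by (split if_split_asm) (simp_all add: rat_adjoin_uminus rat_adjoin_const)

lemma pcoeffs_nonzeroD:
  assumes "x \<in> pcoeffs m \<nu>" and "x \<noteq> 0"
  shows "\<nu> \<in> param_exps n l" and "\<forall>i\<in>{1..n}. L n l p \<nu> i = m i" and "x \<in> rat_adjoin \<zeta>"
  using assms unfolding pcoeffs_def by (simp_all only: split: if_split_asm) simp_all

lemma pcoeffs_mult:
  assumes "x \<in> pcoeffs m \<mu>" and "y \<in> pcoeffs m' \<nu>"
  shows "x * y \<in> pcoeffs (\<lambda>i. m i + m' i) (\<mu> + \<nu>)"
proof (cases "x = 0 \<or> y = 0")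
  case False
  note x = pcoeffs_nonzeroD[OF assms(1)] and y = pcoeffs_nonzeroD[OF assms(2)]
  show ?thesis
    using x y False by (simp add: pcoeffs_def param_exps_add L_add rat_adjoin_field(2))
qed auto

lemma pgrade_altdef: "pgrade m = coeffs_in (pcoeffs m)"
  unfolding R_def coeffs_in_def
proof (intro Collect_cong iffI allI ballI conjI)
  fix f \<nu> assume "\<forall>\<nu>\<in>Poly_Mapping.keys f. Poly_Mapping.lookup f \<nu> \<in> rat_adjoin \<zeta> \<and>
    \<nu> \<in> param_exps n l \<and> (\<forall>i\<in>{1..n}. L n l p \<nu> i = m i)"
  then show "Poly_Mapping.lookup f \<nu> \<in> pcoeffs m \<nu>"
    by (cases "\<nu> \<in> Poly_Mapping.keys f") (simp_all add: pcoeffs_def in_keys_iff rat_adjoin_const)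
next
  fix f :: param_poly and \<nu>
  assume "\<forall>\<nu>. Poly_Mapping.lookup f \<nu> \<in> pcoeffs m \<nu>" and "\<nu> \<in> Poly_Mapping.keys f"
  then have "Poly_Mapping.lookup f \<nu> \<in> pcoeffs m \<nu>" "Poly_Mapping.lookup f \<nu> \<noteq> 0"
    by (simp_all add: in_keys_iff)
  from pcoeffs_nonzeroD[OF this]
  show "Poly_Mapping.lookup f \<nu> \<in> rat_adjoin \<zeta>" "\<nu> \<in> param_exps n l"
    "i \<in> {1..n} \<Longrightarrow> L n l p \<nu> i = m i" for i
    by blast+
qed

lemma pgrade_iff: "f \<in> pgrade m \<longleftrightarrow> (\<forall>\<nu>. Poly_Mapping.lookup f \<nu> \<in> pcoeffs m \<nu>)"
  by (simp add: pgrade_altdef coeffs_in_def)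

lemma pgrade_cong: "(\<And>i. i \<in> {1..n} \<Longrightarrow> m i = m' i) \<Longrightarrow> pgrade m = pgrade m'"
  by (simp add: R_def)

lemma pgrade_zero [simp]: "0 \<in> pgrade m"
  by (simp add: R_def)

lemma pgrade_add: "f \<in> pgrade m \<Longrightarrow> g \<in> pgrade m \<Longrightarrow> f + g \<in> pgrade m"
  by (simp add: pgrade_iff lookup_add pcoeffs_add)

lemma pgrade_uminus: "f \<in> pgrade m \<Longrightarrow> - f \<in> pgrade m"
  by (simp add: pgrade_iff pcoeffs_uminus)

lemma pgrade_mult: "f \<in> pgrade m \<Longrightarrow> g \<in> pgrade m' \<Longrightarrow> f * g \<in> pgrade (\<lambda>i. m i + m' i)"
  unfolding pgrade_altdef by (rule coeffs_in_mult) (auto intro: pcoeffs_add pcoeffs_mult)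

lemma pgrade_Const: "c \<in> rat_adjoin \<zeta> \<Longrightarrow> Const c \<in> pgrade (\<lambda>_. 0)"
  unfolding pgrade_altdef Const_def
  by (rule single_in_coeffs_in, rule pcoeffs_zero) (simp add: pcoeffs_def)

lemma pgrade_Const_mult: "c \<in> rat_adjoin \<zeta> \<Longrightarrow> f \<in> pgrade m \<Longrightarrow> Const c * f \<in> pgrade m"
  using pgrade_mult[OF pgrade_Const, of c f m] by simp

lemma pgrade_Var:
  assumes "k \<in> {1..l}" and "j \<in> {1..n}"
  shows "Var (k, j) \<in> pgrade ((T n ^^ (j - 1)) (p k))"
proof -
  have "Poly_Mapping.single (k, j) 1 \<in> param_exps n l"
    using assms by (simp add: param_exps_def)
  then show ?thesis
    unfolding pgrade_altdef Var_def using L_single[OF assms]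
    by (intro single_in_coeffs_in pcoeffs_zero) (simp add: rat_adjoin_const pcoeffs_def)
qed

text \<open>
  Admissible coefficients of \<open>y^\<alpha>\<close> in a polynomial that is homogeneous of degree \<open>d\<close> and
  all of whose monomials \<open>[\<nu>] y^\<alpha>\<close> have weight \<open>\<alpha> - L(\<nu>) = m\<close>.
\<close>
definition scoeffs :: "nat \<Rightarrow> (nat \<Rightarrow> int) \<Rightarrow> (nat \<Rightarrow>\<^sub>0 nat) \<Rightarrow> param_poly set" where
  "scoeffs d m \<alpha> =
     (if Poly_Mapping.keys \<alpha> \<subseteq> {1..n} \<and> (\<Sum>i=1..n. Poly_Mapping.lookup \<alpha> i) = d
      then pgrade (\<lambda>i. int (Poly_Mapping.lookup \<alpha> i) - m i) else {0})"

lemma scoeffs_zero [simp]: "0 \<in> scoeffs d m \<alpha>"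
  by (simp add: scoeffs_def)

lemma scoeffs_add: "x \<in> scoeffs d m \<alpha> \<Longrightarrow> y \<in> scoeffs d m \<alpha> \<Longrightarrow> x + y \<in> scoeffs d m \<alpha>"
  unfolding scoeffs_def by (split if_split_asm)+ (simp_all add: pgrade_add)

lemma scoeffs_uminus: "x \<in> scoeffs d m \<alpha> \<Longrightarrow> - x \<in> scoeffs d m \<alpha>"
  unfolding scoeffs_def by (split if_split_asm) (simp_all add: pgrade_uminus)

lemma scoeffs_Const_mult:
  "c \<in> rat_adjoin \<zeta> \<Longrightarrow> x \<in> scoeffs d m \<alpha> \<Longrightarrow> Const c * x \<in> scoeffs d m \<alpha>"
  unfolding scoeffs_def by (split if_split_asm) (simp_all add: pgrade_Const_mult)

lemma scoeffs_nonzeroD: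
  assumes "x \<in> scoeffs d m \<alpha>" and "x \<noteq> 0"
  shows "Poly_Mapping.keys \<alpha> \<subseteq> {1..n}" and "(\<Sum>i=1..n. Poly_Mapping.lookup \<alpha> i) = d"
    and "x \<in> pgrade (\<lambda>i. int (Poly_Mapping.lookup \<alpha> i) - m i)"
  using assms unfolding scoeffs_def by (simp_all only: split: if_split_asm) simp_all

lemma scoeffs_mult:
  assumes "x \<in> scoeffs d m \<alpha>" and "y \<in> scoeffs d' m' \<beta>"
  shows "x * y \<in> scoeffs (d + d') (\<lambda>i. m i + m' i) (\<alpha> + \<beta>)"
proof (cases "x = 0 \<or> y = 0")
  case False
  note x = scoeffs_nonzeroD[OF assms(1)] and y = scoeffs_nonzeroD[OF assms(2)]
  have "x * y \<in> pgrade (\<lambda>i. (int (Poly_Mapping.lookup \<alpha> i) - m i) +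
      (int (Poly_Mapping.lookup \<beta> i) - m' i))"
    using False by (intro pgrade_mult x y) auto
  moreover have "(\<lambda>i. (int (Poly_Mapping.lookup \<alpha> i) - m i) +
      (int (Poly_Mapping.lookup \<beta> i) - m' i)) =
      (\<lambda>i. int (Poly_Mapping.lookup (\<alpha> + \<beta>) i) - (m i + m' i))"
    by (auto simp: lookup_add)
  moreover have "Poly_Mapping.keys (\<alpha> + \<beta>) \<subseteq> {1..n}"
    using x(1) y(1) False keys_add[of \<alpha> \<beta>] by blast
  ultimately show ?thesis
    using x(2) y(2) False by (simp add: scoeffs_def lookup_add sum.distrib)
qed auto

definition sgrade :: "nat \<Rightarrow> (nat \<Rightarrow> int) \<Rightarrow> state_poly set" where
  "sgrade d m = coeffs_in (scoeffs d m)"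

lemma sgrade_iff: "f \<in> sgrade d m \<longleftrightarrow> (\<forall>\<alpha>. Poly_Mapping.lookup f \<alpha> \<in> scoeffs d m \<alpha>)"
  by (simp add: sgrade_def coeffs_in_def)

lemma sgrade_keysD:
  assumes "f \<in> sgrade d m" and "\<alpha> \<in> Poly_Mapping.keys f"
  shows "Poly_Mapping.keys \<alpha> \<subseteq> {1..n}" and "(\<Sum>i=1..n. Poly_Mapping.lookup \<alpha> i) = d"
    and "Poly_Mapping.lookup f \<alpha> \<in> pgrade (\<lambda>i. int (Poly_Mapping.lookup \<alpha> i) - m i)"
  using scoeffs_nonzeroD[of "Poly_Mapping.lookup f \<alpha>" d m \<alpha>] assms
  by (simp_all add: sgrade_iff in_keys_iff)

text \<open>
  Computing the weight of a product yields a function on all natural numbers that agrees with the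
  expected one only on \<open>{1..n}\<close>.
\<close>
lemma sgrade_cong:
  assumes "\<And>i. i \<in> {1..n} \<Longrightarrow> m i = m' i"
  shows "sgrade d m = sgrade d m'"
proof -
  have "pgrade (\<lambda>i. int (Poly_Mapping.lookup \<alpha> i) - m i) =
      pgrade (\<lambda>i. int (Poly_Mapping.lookup \<alpha> i) - m' i)" for \<alpha>
    by (rule pgrade_cong) (simp add: assms)
  then have "scoeffs d m = scoeffs d m'"
    by (simp add: fun_eq_iff scoeffs_def)
  then show ?thesis by (simp add: sgrade_def)
qed

lemma sgrade_zero [simp]: "0 \<in> sgrade d m"
  by (simp add: sgrade_iff)

lemma sgrade_add: "f \<in> sgrade d m \<Longrightarrow> g \<in> sgrade d m \<Longrightarrow> f + g \<in> sgrade d m"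
  by (simp add: sgrade_iff lookup_add scoeffs_add)

lemma sgrade_diff: "f \<in> sgrade d m \<Longrightarrow> g \<in> sgrade d m \<Longrightarrow> f - g \<in> sgrade d m"
  using scoeffs_add[OF _ scoeffs_uminus] by (fastforce simp: sgrade_iff lookup_minus)

lemma sgrade_sum: "(\<And>i. i \<in> I \<Longrightarrow> f i \<in> sgrade d m) \<Longrightarrow> sum f I \<in> sgrade d m"
  by (induction I rule: infinite_finite_induct) (simp_all add: sgrade_add)

lemma sgrade_mult:
  "f \<in> sgrade d m \<Longrightarrow> g \<in> sgrade d' m' \<Longrightarrow> f * g \<in> sgrade (d + d') (\<lambda>i. m i + m' i)"
  unfolding sgrade_def by (rule coeffs_in_mult) (auto intro: scoeffs_add scoeffs_mult)

lemma sgrade_single: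
  assumes "Poly_Mapping.keys \<alpha> \<subseteq> {1..n}" and "(\<Sum>i=1..n. Poly_Mapping.lookup \<alpha> i) = d"
    and "c \<in> pgrade (\<lambda>i. int (Poly_Mapping.lookup \<alpha> i) - m i)"
  shows "Poly_Mapping.single \<alpha> c \<in> sgrade d m"
  unfolding sgrade_def using assms by (intro single_in_coeffs_in) (simp_all add: scoeffs_def)

text \<open>A parameter monomial \<open>[\<nu>]\<close> without states has \<open>\<alpha> = 0\<close> and hence the weight \<open>- L(\<nu>)\<close>.\<close>
lemma sgrade_Const: "c \<in> pgrade m \<Longrightarrow> Const c \<in> sgrade 0 (\<lambda>i. - m i)"
  unfolding Const_def by (rule sgrade_single) auto

lemma sgrade_Var: "j \<in> {1..n} \<Longrightarrow> Var j \<in> sgrade 1 (\<lambda>i. if i = j then 1 else 0)"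
  unfolding Var_def
proof (rule sgrade_single)
  show "1 \<in> pgrade (\<lambda>i. int (Poly_Mapping.lookup (Poly_Mapping.single j 1) i) - (if i = j then 1 else 0))"
    using pgrade_Const[OF rat_adjoin_const(2)]
    by (simp add: Const_def lookup_single when_def if_distrib cong: if_cong)
qed (auto simp: lookup_single when_def)

lemma sgrade_homogeneous: "f \<in> sgrade d m \<Longrightarrow> homogeneous n l d f"
  unfolding homogeneous_def
proof (intro ballI conjI)
  fix \<alpha> assume f: "f \<in> sgrade d m" and \<alpha>: "\<alpha> \<in> Poly_Mapping.keys f"
  note a = sgrade_keysD[OF this]
  show "Poly_Mapping.keys \<alpha> \<subseteq> {1..n}" "(\<Sum>i=1..n. Poly_Mapping.lookup \<alpha> i) = d"
    by (rule a)+
  show "Poly_Mapping.keys (Poly_Mapping.lookup f \<alpha>) \<subseteq> param_exps n l"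
    using a(3) by (auto simp: R_def)
qed

text \<open>
  Multiplying each \<open>y^\<alpha>\<close> by its own scalar, as in solving the homological equation, does not
  change the monomials \<open>[\<nu>] y^\<alpha>\<close> that occur, up to losing some of them.
\<close>
lemma sgrade_mapp:
  assumes "f \<in> sgrade d m" and "\<And>\<alpha>. c \<alpha> \<in> rat_adjoin \<zeta>"
  shows "Poly_Mapping.mapp (\<lambda>\<alpha> x. Const (c \<alpha>) * x) f \<in> sgrade d m"
  using assms by (simp add: sgrade_iff lookup_mapp when_def scoeffs_Const_mult)

lemma sgrade_partial:
  assumes "f \<in> sgrade (Suc d) m"
  shows "partial i f \<in> sgrade d (\<lambda>x. m x - (if x = i then 1 else 0))"
  unfolding partial_def
proof (rule sgrade_sum)
  fix \<alpha> assume "\<alpha> \<in> Poly_Mapping.keys f"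
  note a = sgrade_keysD[OF assms this]
  let ?e = "Poly_Mapping.single i (1::nat)"
  show "Poly_Mapping.single (\<alpha> - ?e) (of_nat (Poly_Mapping.lookup \<alpha> i) * Poly_Mapping.lookup f \<alpha>)
      \<in> sgrade d (\<lambda>x. m x - (if x = i then 1 else 0))"
  proof (cases "Poly_Mapping.lookup \<alpha> i = 0")
    case False
    then have i: "i \<in> {1..n}" using a(1) by (meson in_keys_iff subsetD)
    have split: "Poly_Mapping.lookup \<alpha> x = Poly_Mapping.lookup (\<alpha> - ?e) x + (if x = i then 1 else 0)" for x
      using False by (auto simp: lookup_minus lookup_single when_def)
    have "Suc d = (\<Sum>x=1..n. Poly_Mapping.lookup (\<alpha> - ?e) x) + 1"
      using i by (simp only: a(2)[symmetric] split sum.distrib) simp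
    moreover have "Poly_Mapping.keys (\<alpha> - ?e) \<subseteq> {1..n}"
      using a(1) by (auto simp: in_keys_iff lookup_minus)
    moreover have "of_nat (Poly_Mapping.lookup \<alpha> i) * Poly_Mapping.lookup f \<alpha> \<in>
        pgrade (\<lambda>i. int (Poly_Mapping.lookup \<alpha> i) - m i)"
      using pgrade_Const_mult[OF rat_adjoin_const(3) a(3)] by (simp add: Const_def single_of_nat)
    moreover have "(\<lambda>i. int (Poly_Mapping.lookup \<alpha> i) - m i) =
        (\<lambda>x. int (Poly_Mapping.lookup (\<alpha> - ?e) x) - (m x - (if x = i then 1 else 0)))"
      by (rule ext) (subst split, simp)
    ultimately show ?thesis by (intro sgrade_single) auto
  qed simp
qed

definition fgrade :: "(nat \<Rightarrow> int) \<Rightarrow> state_poly fps set" where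
  "fgrade m = {f. \<forall>d. fps_nth f d \<in> sgrade d m}"

lemma fgrade_cong: "(\<And>i. i \<in> {1..n} \<Longrightarrow> m i = m' i) \<Longrightarrow> fgrade m = fgrade m'"
  unfolding fgrade_def by (subst sgrade_cong[of m m']) simp_all

lemma fgrade_const: "c \<in> pgrade m \<Longrightarrow> fps_const (Const c) \<in> fgrade (\<lambda>i. - m i)"
  unfolding fgrade_def by (auto dest: sgrade_Const)

lemma fgrade_one: "1 \<in> fgrade (\<lambda>_. 0)"
  using fgrade_const[OF pgrade_Const[OF rat_adjoin_const(2)]] by (simp add: Const_def)

lemma fgrade_mult: "f \<in> fgrade m \<Longrightarrow> g \<in> fgrade m' \<Longrightarrow> f * g \<in> fgrade (\<lambda>i. m i + m' i)"
proof -
  assume fg: "f \<in> fgrade m" "g \<in> fgrade m'"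
  have "fps_nth f i * fps_nth g (d - i) \<in> sgrade d (\<lambda>i. m i + m' i)" if "i \<le> d" for i d
    using sgrade_mult[of "fps_nth f i" i m "fps_nth g (d - i)" "d - i" m'] fg that
    by (simp add: fgrade_def)
  then show ?thesis
    by (auto simp: fgrade_def fps_mult_nth intro!: sgrade_sum)
qed

lemma fgrade_sum: "(\<And>i. i \<in> I \<Longrightarrow> f i \<in> fgrade m) \<Longrightarrow> sum f I \<in> fgrade m"
  by (auto simp: fgrade_def fps_sum_nth intro!: sgrade_sum)

lemma fgrade_power: "f \<in> fgrade m \<Longrightarrow> f ^ k \<in> fgrade (\<lambda>i. int k * m i)"
proof (induction k)
  case (Suc k)
  then show ?case using fgrade_mult[of f m "f ^ k" "\<lambda>i. int k * m i"] by (simp add: algebra_simps)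
qed (simp add: fgrade_one)

lemma fgrade_prod:
  "(\<And>i. i \<in> I \<Longrightarrow> f i \<in> fgrade (m i)) \<Longrightarrow> prod f I \<in> fgrade (\<lambda>x. \<Sum>i\<in>I. m i x)"
proof (induction I rule: infinite_finite_induct)
  case (insert i I)
  then show ?case using fgrade_mult[of "f i" "m i"] by simp
qed (simp_all add: fgrade_one)

end

section \<open>Substitution and differentiation of polynomials\<close>

lemma Const_zero: "Const 0 = 0" and Const_one: "Const 1 = 1"
  and Const_add: "Const (x + y) = Const x + Const y"
  and Const_mult: "Const (x * y) = Const x * Const y"
  and Const_of_nat: "Const (of_nat m) = of_nat m"
  by (simp_all add: Const_def single_add mult_single)

lemma Const_sum: "Const (sum f I) = (\<Sum>i\<in>I. Const (f i))"
  by (induction I rule: infinite_finite_induct) (simp_all add: Const_zero Const_add)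

lemma Const_mult_single:
  "Const c * Poly_Mapping.single \<alpha> x = Poly_Mapping.single \<alpha> (c * x)"
  by (simp add: Const_def mult_single)

lemma lookup_Const_mult: "Poly_Mapping.lookup (Const c * f) \<alpha> = c * Poly_Mapping.lookup f \<alpha>"
proof -
  have "Const c * f = (\<Sum>\<beta>\<in>Poly_Mapping.keys f. Poly_Mapping.single \<beta> (c * Poly_Mapping.lookup f \<beta>))"
    by (subst (1) sum_singles[symmetric]) (simp only: sum_distrib_left Const_mult_single)
  then show ?thesis
    by (simp add: lookup_sum lookup_single when_def in_keys_iff)
qed

lemma Var_power: "Var i ^ e = Poly_Mapping.single (Poly_Mapping.single i e) 1"
  by (induction e) (simp_all add: Var_def mult_single single_add[symmetric])

lemma prod_Var_power:
  "(\<Prod>i\<in>I. Var i ^ e i) = Poly_Mapping.single (\<Sum>i\<in>I. Poly_Mapping.single i (e i)) 1"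
  by (induction I rule: infinite_finite_induct) (simp_all add: Var_power mult_single)

lemma lookup_sum_single:
  "finite I \<Longrightarrow> Poly_Mapping.lookup (\<Sum>i\<in>I. Poly_Mapping.single i (e i)) j = (if j \<in> I then e j else 0)"
  by (simp add: lookup_sum lookup_single when_def)

text \<open>Summation over a common set of exponents makes additivity of the substitution visible.\<close>
lemma subst_superset:
  assumes "finite S" and "Poly_Mapping.keys f \<subseteq> S"
  shows "subst n \<Phi> f = (\<Sum>\<alpha>\<in>S. fps_const (Const (Poly_Mapping.lookup f \<alpha>)) *
    (\<Prod>i=1..n. \<Phi> i ^ Poly_Mapping.lookup \<alpha> i))"
  unfolding subst_def using assms
  by (intro sum.mono_neutral_left) (auto simp: in_keys_iff Const_zero)

lemma subst_add: "subst n \<Phi> (f + g) = subst n \<Phi> f + subst n \<Phi> g"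
proof -
  let ?S = "Poly_Mapping.keys f \<union> Poly_Mapping.keys g"
  show ?thesis
    using keys_add[of f g]
    by (simp add: subst_superset[of ?S] lookup_add Const_add sum.distrib algebra_simps
        fps_const_add[symmetric] del: fps_const_add)
qed

lemma subst_zero: "subst n \<Phi> 0 = 0"
  by (simp add: subst_def)

lemma subst_sum: "subst n \<Phi> (sum f I) = (\<Sum>i\<in>I. subst n \<Phi> (f i))"
  by (induction I rule: infinite_finite_induct) (simp_all add: subst_zero subst_add)

lemma subst_monomial:
  "subst n \<Phi> (Const c * (\<Prod>i=1..n. Var i ^ e i)) = fps_const (Const c) * (\<Prod>i=1..n. \<Phi> i ^ e i)"
proof -
  let ?\<alpha> = "\<Sum>i=1..n. Poly_Mapping.single i (e i)"
  have "subst n \<Phi> (Poly_Mapping.single ?\<alpha> c) =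
      fps_const (Const c) * (\<Prod>i=1..n. \<Phi> i ^ Poly_Mapping.lookup ?\<alpha> i)"
    by (subst subst_superset[of "{?\<alpha>}"]) auto
  also have "(\<Prod>i=1..n. \<Phi> i ^ Poly_Mapping.lookup ?\<alpha> i) = (\<Prod>i=1..n. \<Phi> i ^ e i)"
    by (intro prod.cong) (simp_all add: lookup_sum_single)
  finally show ?thesis
    by (simp only: prod_Var_power Const_mult_single mult_1_right)
qed

lemma subst_Const_Var:
  assumes "j \<in> {1..n}"
  shows "subst n \<Phi> (Const c * Var j) = fps_const (Const c) * \<Phi> j"
proof -
  have delta: "(\<Prod>i=1..n. f i ^ (if i = j then 1 else 0)) = f j" for f :: "nat \<Rightarrow> 'a::comm_monoid_mult"
    using assms by (simp add: if_distrib[of "\<lambda>e. _ ^ e"] cong: if_cong)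
  show ?thesis
    using subst_monomial[of n \<Phi> c "\<lambda>i. if i = j then 1 else 0"] by (simp only: delta)
qed

lemma partial_Var: "partial i (Var j) = (if i = j then 1 else 0)"
  by (simp add: partial_def Var_def lookup_single when_def)

text \<open>
  The derivative in the direction of a diagonal linear vector field acts diagonally on monomials.
  This turns the homological equation into scalar equations.
\<close>
lemma lookup_Euler:
  "Poly_Mapping.lookup (\<Sum>i=1..n. partial i f * (Const (Const (c i)) * Var i)) \<alpha> =
     Const (\<Sum>i=1..n. of_nat (Poly_Mapping.lookup \<alpha> i) * c i) * Poly_Mapping.lookup f \<alpha>"
proof -
  have "partial i f * (Const (Const (c i)) * Var i) =
      (\<Sum>\<beta>\<in>Poly_Mapping.keys f. Poly_Mapping.single \<beta>
        (Const (of_nat (Poly_Mapping.lookup \<beta> i) * c i) * Poly_Mapping.lookup f \<beta>))" for i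
    unfolding partial_def sum_distrib_right
  proof (rule sum.cong)
    fix \<beta>
    let ?e = "Poly_Mapping.single i (1::nat)"
    show "Poly_Mapping.single (\<beta> - ?e) (of_nat (Poly_Mapping.lookup \<beta> i) * Poly_Mapping.lookup f \<beta>) *
          (Const (Const (c i)) * Var i) =
        Poly_Mapping.single \<beta> (Const (of_nat (Poly_Mapping.lookup \<beta> i) * c i) * Poly_Mapping.lookup f \<beta>)"
    proof (cases "Poly_Mapping.lookup \<beta> i = 0")
      case False
      then have "\<beta> - ?e + ?e = \<beta>"
        by (intro poly_mapping_eqI) (auto simp: lookup_add lookup_minus lookup_single when_def)
      then show ?thesis
        by (simp add: Var_def Const_mult_single mult_single Const_mult Const_of_nat ac_simps)
    qed (simp add: Const_zero)
  qed simp
  then have "Poly_Mapping.lookup (partial i f * (Const (Const (c i)) * Var i)) \<alpha> =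
      Const (of_nat (Poly_Mapping.lookup \<alpha> i) * c i) * Poly_Mapping.lookup f \<alpha>" for i
    by (simp add: lookup_sum lookup_single when_def in_keys_iff)
  then show ?thesis
    by (simp add: lookup_sum Const_sum sum_distrib_right)
qed

section \<open>Dependence of products of power series on low coefficients\<close>

lemma prod_power_factor_X:
  fixes \<Phi> :: "'i \<Rightarrow> 'a::comm_ring_1 fps"
  assumes "\<And>i. i \<in> I \<Longrightarrow> fps_nth (\<Phi> i) 0 = 0"
  shows "(\<Prod>i\<in>I. \<Phi> i ^ e i) = fps_X ^ (\<Sum>i\<in>I. e i) * (\<Prod>i\<in>I. fps_shift 1 (\<Phi> i) ^ e i)"
proof -
  have "\<Phi> i = fps_X * fps_shift 1 (\<Phi> i)" if "i \<in> I" for i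
  proof (rule fps_ext)
    show "fps_nth (\<Phi> i) d = fps_nth (fps_X * fps_shift 1 (\<Phi> i)) d" for d
      using assms[OF that] by (cases d) (auto simp: fps_X_mult_nth)
  qed
  then have "(\<Prod>i\<in>I. \<Phi> i ^ e i) = (\<Prod>i\<in>I. (fps_X * fps_shift 1 (\<Phi> i)) ^ e i)"
    by (intro prod.cong) auto
  also have "\<dots> = fps_X ^ (\<Sum>i\<in>I. e i) * (\<Prod>i\<in>I. fps_shift 1 (\<Phi> i) ^ e i)"
    by (simp only: power_mult_distrib prod.distrib power_sum)
  finally show ?thesis .
qed

lemma prod_power_nth_cong:
  fixes \<Phi> \<Psi> :: "'i \<Rightarrow> 'a::comm_ring_1 fps"
  assumes "\<And>i k. i \<in> I \<Longrightarrow> k < d \<Longrightarrow> fps_nth (\<Phi> i) k = fps_nth (\<Psi> i) k" and "k < d"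
  shows "fps_nth (\<Prod>i\<in>I. \<Phi> i ^ e i) k = fps_nth (\<Prod>i\<in>I. \<Psi> i ^ e i) k"
proof -
  have mult: "\<forall>k<d. fps_nth (f * g) k = fps_nth (f' * g') k"
    if "\<forall>k<d. fps_nth f k = fps_nth f' k" "\<forall>k<d. fps_nth g k = fps_nth g' k" for f f' g g' :: "'a fps"
    using that by (auto simp: fps_mult_nth)
  have power: "\<forall>k<d. fps_nth (f ^ m) k = fps_nth (f' ^ m) k"
    if "\<forall>k<d. fps_nth f k = fps_nth f' k" for f f' :: "'a fps" and m
    by (induction m) (use that mult in simp_all)
  have "\<forall>k<d. fps_nth (\<Prod>i\<in>I. \<Phi> i ^ e i) k = fps_nth (\<Prod>i\<in>I. \<Psi> i ^ e i) k"
    using assms(1)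
    by (induction I rule: infinite_finite_induct) (simp_all add: mult power)
  with assms(2) show ?thesis by blast
qed

text \<open>
  For series without constant term, a product of at least two factors is divisible by \<open>X\<^sup>2\<close>
  when one \<open>X\<close> is taken from each factor. So its coefficient of degree \<open>d\<close> only involves
  coefficients of the factors of degree less than \<open>d\<close>; this is what makes the homological
  equations solvable one degree after the other.
\<close>
lemma prod_power_nth_local:
  fixes \<Phi> \<Psi> :: "'i \<Rightarrow> 'a::comm_ring_1 fps"
  assumes "\<And>i. i \<in> I \<Longrightarrow> fps_nth (\<Phi> i) 0 = 0" and "\<And>i. i \<in> I \<Longrightarrow> fps_nth (\<Psi> i) 0 = 0"
    and "\<And>i k. i \<in> I \<Longrightarrow> k < d \<Longrightarrow> fps_nth (\<Phi> i) k = fps_nth (\<Psi> i) k"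
    and "(\<Sum>i\<in>I. e i) \<ge> 2"
  shows "fps_nth (\<Prod>i\<in>I. \<Phi> i ^ e i) d = fps_nth (\<Prod>i\<in>I. \<Psi> i ^ e i) d"
proof (cases "d < (\<Sum>i\<in>I. e i)")
  case False
  have "fps_nth (\<Prod>i\<in>I. fps_shift 1 (\<Phi> i) ^ e i) (d - (\<Sum>i\<in>I. e i)) =
      fps_nth (\<Prod>i\<in>I. fps_shift 1 (\<Psi> i) ^ e i) (d - (\<Sum>i\<in>I. e i))"
    \<comment> \<open>The shifted series agree below degree \<open>d - 1\<close>, and at least two factors \<open>X\<close> were taken out.\<close>
    by (rule prod_power_nth_cong[where d = "d - 1"]) (use assms(3,4) False in auto)
  then show ?thesis
    using False by (simp add: prod_power_factor_X assms(1,2) fps_X_power_mult_nth)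
qed (simp add: prod_power_factor_X assms(1,2) fps_X_power_mult_nth)

lemma prod_power_nth_low:
  fixes \<Phi> :: "'i \<Rightarrow> 'a::comm_ring_1 fps"
  assumes "\<And>i. i \<in> I \<Longrightarrow> fps_nth (\<Phi> i) 0 = 0" and "d < (\<Sum>i\<in>I. e i)"
  shows "fps_nth (\<Prod>i\<in>I. \<Phi> i ^ e i) d = 0"
  using assms by (simp add: prod_power_factor_X fps_X_power_mult_nth)

section \<open>Cyclic shifts of the exponent vectors\<close>

lemma T_funpow:
  assumes "m < n" and "i \<in> {1..n}"
  shows "(T n ^^ m) v i = v (if i \<le> m then i + n - m else i - m)"
  using assms
proof (induction m arbitrary: i)
  case (Suc m)
  show ?case
  proof (cases "i = 1")
    case True
    then show ?thesis using Suc.IH[of n] Suc.prems by (simp add: T_def)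
  next
    case False
    then have "(T n ^^ Suc m) v i = (T n ^^ m) v (i - 1)"
      using Suc.prems by (simp add: T_def[of n "(T n ^^ m) v"])
    also have "\<dots> = v (if i - 1 \<le> m then i - 1 + n - m else i - 1 - m)"
      using Suc.prems False by (intro Suc.IH) auto
    also have "\<dots> = v (if i \<le> Suc m then i + n - Suc m else i - Suc m)"
      using Suc.prems False by (intro arg_cong[of _ _ v]) auto
    finally show ?thesis .
  qed
qed auto

lemma sum_T_funpow: "n \<ge> 1 \<Longrightarrow> (\<Sum>i=1..n. (T n ^^ m) v i) = (\<Sum>i=1..n. v i)"
proof (induction m)
  case (Suc m)
  have "(\<Sum>i=1..n. T n w i) = (\<Sum>i=1..n. w i)" for w
  proof -
    have "(\<Sum>i=1..n. T n w i) = w n + (\<Sum>i\<in>{2..n}. T n w i)"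
      using Suc.prems by (simp add: sum.atLeast_Suc_atMost T_def numeral_2_eq_2)
    also have "(\<Sum>i\<in>{2..n}. T n w i) = (\<Sum>i\<in>{1..<n}. w i)"
      by (rule sum.reindex_bij_witness[of _ "\<lambda>i. i + 1" "\<lambda>i. i - 1"]) (auto simp: T_def)
    also have "w n + \<dots> = (\<Sum>i=1..n. w i)"
      using Suc.prems by (simp add: sum.last_plus)
    finally show ?thesis .
  qed
  with Suc show ?case by simp
qed simp

locale cyclic_system = cyclic_grading +
  assumes prime_n: "prime n" and n_gt_2: "n > 2"
    and primitive: "primitive_root_of_unity n \<zeta>"
    and exponents: "\<And>k. k \<in> {1..l} \<Longrightarrow>
      p k 1 \<ge> -1 \<and> (\<forall>i\<in>{2..n}. p k i \<ge> 0) \<and> (\<Sum>i=1..n. p k i) \<ge> 1"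
begin

lemma zeta: "\<zeta> ^ n = 1" "\<zeta> \<noteq> 1"
  using primitive n_gt_2 unfolding primitive_root_of_unity_def
  by (blast, metis atLeastLessThan_iff le_refl less_trans one_less_numeral_iff power_one_right semiring_norm(76))

definition \<delta> :: "nat \<Rightarrow> nat \<Rightarrow> int" where
  "\<delta> j = (\<lambda>i. if i = j then 1 else 0)"

text \<open>
  The exponent of \<open>x\<^sub>i\<close> in the monomial of the parameter \<open>(k, j)\<close>, including the factor
  \<open>x\<^sub>j\<close> in front of the bracket.
\<close>
definition exponent :: "nat \<Rightarrow> nat \<Rightarrow> nat \<Rightarrow> nat" where
  "exponent k j i = nat ((T n ^^ (j - 1)) (p k) i + \<delta> j i)"

text \<open>
  The shift by \<open>j - 1\<close> moves the first entry of \<open>p k\<close>, the only one that may be \<open>-1\<close>, to position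
  \<open>j\<close>. There the additional factor \<open>x\<^sub>j\<close> makes up for it.
\<close>
lemma int_exponent:
  assumes "k \<in> {1..l}" and "j \<in> {1..n}" and "i \<in> {1..n}"
  shows "int (exponent k j i) = (T n ^^ (j - 1)) (p k) i + \<delta> j i"
proof -
  have "(T n ^^ (j - 1)) (p k) i = p k (if i \<le> j - 1 then i + n - (j - 1) else i - (j - 1))"
    using assms(2,3) by (intro T_funpow) auto
  moreover have "p k (if i \<le> j - 1 then i + n - (j - 1) else i - (j - 1)) + \<delta> j i \<ge> 0"
  proof (cases "i = j")
    case True
    then have "(if i \<le> j - 1 then i + n - (j - 1) else i - (j - 1)) = 1"
      using assms(2) by auto
    then show ?thesis using exponents[OF assms(1)] True by (simp only: \<delta>_def) auto
  next
    case False
    then have "(if i \<le> j - 1 then i + n - (j - 1) else i - (j - 1)) \<in> {2..n}"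
      using assms(2,3) by auto
    then show ?thesis using exponents[OF assms(1)] False by (simp only: \<delta>_def) auto
  qed
  ultimately show ?thesis by (simp add: exponent_def)
qed

lemma sum_exponent:
  assumes "k \<in> {1..l}" and "j \<in> {1..n}"
  shows "(\<Sum>i=1..n. exponent k j i) \<ge> 2"
proof -
  have "int (\<Sum>i=1..n. exponent k j i) = (\<Sum>i=1..n. (T n ^^ (j - 1)) (p k) i + \<delta> j i)"
    unfolding of_nat_sum by (intro sum.cong int_exponent assms refl)
  also have "\<dots> = (\<Sum>i=1..n. p k i) + 1"
    using assms(2) n_gt_2 sum_T_funpow[of n "j - 1" "p k"] by (simp add: sum.distrib \<delta>_def)
  finally show ?thesis
    using exponents[OF assms(1)] by linarith
qed

section \<open>Resonant monomials\<close>

definition eigenvalue :: "(nat \<Rightarrow>\<^sub>0 nat) \<Rightarrow> complex" where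
  "eigenvalue \<alpha> = (\<Sum>i=1..n. of_nat (Poly_Mapping.lookup \<alpha> i) * \<zeta> ^ (i - 1))"

text \<open>
  The relation \<open>\<Sum>\<^sub>i (\<alpha>\<^sub>i - \<delta>\<^sub>i\<^sub>k) \<zeta>^(i-1) = 0\<close> has constant coefficients. The constant is a
  natural number because it is also an entry of \<open>\<alpha>\<close> at a position other than \<open>k\<close>.
\<close>
lemma resonance:
  assumes "eigenvalue \<alpha> = \<zeta> ^ (k - 1)" and k: "k \<in> {1..n}"
  obtains c where "\<And>i. i \<in> {1..n} \<Longrightarrow> Poly_Mapping.lookup \<alpha> i = c + (if i = k then 1 else 0)"
proof -
  define a :: "nat \<Rightarrow> int" where
    "a i = int (Poly_Mapping.lookup \<alpha> (i + 1)) - (if i + 1 = k then 1 else 0)" for i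
  have "(\<Sum>i<n. of_int (a i) * \<zeta> ^ i) =
      (\<Sum>i=1..n. (of_nat (Poly_Mapping.lookup \<alpha> i) - (if i = k then 1 else 0)) * \<zeta> ^ (i - 1))"
    by (rule sum.reindex_bij_witness[of _ "\<lambda>i. i - 1" "\<lambda>i. i + 1"]) (auto simp: a_def)
  also have "\<dots> = eigenvalue \<alpha> - (\<Sum>i=1..n. if i = k then \<zeta> ^ (i - 1) else 0)"
    unfolding eigenvalue_def sum_subtractf[symmetric]
    by (intro sum.cong) (auto simp: algebra_simps)
  also have "\<dots> = 0" using assms by simp
  finally have const: "a i = a (n - 1)" if "i < n" for i
    using integer_relation_root_of_unity[OF prime_n zeta] that by blast
  obtain i where "i < n" "i + 1 \<noteq> k"
    using n_gt_2 by (cases "k = 1") (force, metis One_nat_def add_0 gr_implies_not0 neq0_conv)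
  then have "a (n - 1) \<ge> 0"
    using const[of i] by (simp add: a_def)
  show thesis
  proof
    fix i assume i: "i \<in> {1..n}"
    then have "a (i - 1) = a (n - 1)" by (intro const) auto
    then have "int (Poly_Mapping.lookup \<alpha> i) = a (n - 1) + (if i = k then 1 else 0)"
      using i by (simp add: a_def split: if_splits)
    then show "Poly_Mapping.lookup \<alpha> i = nat (a (n - 1)) + (if i = k then 1 else 0)"
      using \<open>a (n - 1) \<ge> 0\<close> by (simp split: if_splits)
  qed
qed

section \<open>The homological equation\<close>

definition nonlinear_part :: "(nat \<Rightarrow> state_poly fps) \<Rightarrow> nat \<Rightarrow> state_poly fps" where
  "nonlinear_part \<Phi> j =
     (\<Sum>k=1..l. fps_const (Const (Var (k, j))) * (\<Prod>i=1..n. \<Phi> i ^ exponent k j i))"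

lemma subst_system:
  assumes "j \<in> {1..n}"
  shows "subst n \<Phi> (system_rhs n l \<zeta> p j) =
    fps_const (Const (Const (\<zeta> ^ (j - 1)))) * \<Phi> j + nonlinear_part \<Phi> j"
  unfolding system_rhs_def nonlinear_part_def subst_add subst_sum subst_Const_Var[OF assms]
    subst_monomial exponent_def \<delta>_def by simp

text \<open>
  The right-hand side \<open>N\<close> of the homological equation of degree \<open>d\<close>: the part of degree \<open>d\<close> of
  the nonlinear terms of \<open>f(\<Phi>(y))\<close>, minus the products in \<open>D\<Phi>(y) g(y)\<close> of two nonlinear terms.
  Since \<open>e + 1\<close> runs from 2 to \<open>d - 1\<close>, so does \<open>d - e\<close>.
\<close>
definition obstruction ::
  "(nat \<Rightarrow> nat \<Rightarrow> state_poly) \<Rightarrow> (nat \<Rightarrow> nat \<Rightarrow> state_poly) \<Rightarrow> nat \<Rightarrow> nat \<Rightarrow> state_poly" where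
  "obstruction H G d j = fps_nth (nonlinear_part (transformation H) j) d -
     (\<Sum>i=1..n. \<Sum>e=1..d-2. partial i (H (e + 1) j) * G (d - e) i)"

lemma transformation_nth:
  "fps_nth (transformation H i) d = (if d = 0 then 0 else if d = 1 then Var i else H d i)"
  by (simp add: transformation_def expansion_def)

lemma transformed_rhs_nth:
  "fps_nth (transformed_rhs \<zeta> G i) d =
    (if d = 0 then 0 else if d = 1 then Const (Const (\<zeta> ^ (i - 1))) * Var i else G d i)"
  by (simp add: transformed_rhs_def expansion_def)

lemma nonlinear_part_low:
  assumes "j \<in> {1..n}" and "d < 2"
  shows "fps_nth (nonlinear_part (transformation H) j) d = 0"
proof -
  have "fps_nth (\<Prod>i=1..n. transformation H i ^ exponent k j i) d = 0" if "k \<in> {1..l}" for k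
    using sum_exponent[OF that assms(1)] assms(2)
    by (intro prod_power_nth_low) (auto simp: transformation_nth)
  then show ?thesis
    by (simp add: nonlinear_part_def fps_sum_nth)
qed

lemma obstruction_cong:
  assumes "j \<in> {1..n}"
    and eq: "\<And>e i. e < d \<Longrightarrow> H e i = H' e i" "\<And>e i. e < d \<Longrightarrow> G e i = G' e i"
  shows "obstruction H G d j = obstruction H' G' d j"
proof -
  have "fps_nth (\<Prod>i=1..n. transformation H i ^ exponent k j i) d =
      fps_nth (\<Prod>i=1..n. transformation H' i ^ exponent k j i) d" if "k \<in> {1..l}" for k
    using sum_exponent[OF that assms(1)] eq
    by (intro prod_power_nth_local) (auto simp: transformation_nth)
  then have "fps_nth (nonlinear_part (transformation H) j) d =
      fps_nth (nonlinear_part (transformation H') j) d"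
    by (simp add: nonlinear_part_def fps_sum_nth)
  moreover have "partial i (H (e + 1) j) * G (d - e) i = partial i (H' (e + 1) j) * G' (d - e) i"
    if "e \<in> {1..d-2}" for i e
    using that by (auto simp: eq)
  ultimately show ?thesis by (simp add: obstruction_def)
qed

text \<open>
  The factor \<open>Var (k, j)\<close> has weight \<open>- T^(j-1)(p k)\<close>. The product of powers of the
  components \<open>\<Phi>\<^sub>i\<close>, of weight \<open>e\<^sub>i\<close>, has the same weight as the monomial in the states that
  is replaced, namely \<open>T^(j-1)(p k) + e\<^sub>j\<close>. In the correction terms
  \<open>\<partial>\<^sub>i H\<^sub>j \<cdot> G\<^sub>i\<close> the weight \<open>- e\<^sub>i\<close> of the derivative cancels with that of \<open>G\<^sub>i\<close>.
\<close>
lemma obstruction_grade: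
  assumes "j \<in> {1..n}"
    and H: "\<And>e i. e \<ge> 2 \<Longrightarrow> i \<in> {1..n} \<Longrightarrow> H e i \<in> sgrade e (\<delta> i)"
    and G: "\<And>e i. e \<ge> 2 \<Longrightarrow> i \<in> {1..n} \<Longrightarrow> G e i \<in> sgrade e (\<delta> i)"
  shows "obstruction H G d j \<in> sgrade d (\<delta> j)"
  unfolding obstruction_def
proof (intro sgrade_diff sgrade_sum)
  have \<Phi>: "transformation H i \<in> fgrade (\<delta> i)" if "i \<in> {1..n}" for i
    using H sgrade_Var that by (auto simp: fgrade_def transformation_nth \<delta>_def)
  have "fps_const (Const (Var (k, j))) * (\<Prod>i=1..n. transformation H i ^ exponent k j i) \<in> fgrade (\<delta> j)"
    if k: "k \<in> {1..l}" for k
  proof -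
    have "fps_const (Const (Var (k, j))) * (\<Prod>i=1..n. transformation H i ^ exponent k j i) \<in>
        fgrade (\<lambda>x. - (T n ^^ (j - 1)) (p k) x + (\<Sum>i=1..n. int (exponent k j i) * \<delta> i x))"
      by (intro fgrade_mult fgrade_const fgrade_prod fgrade_power pgrade_Var \<Phi> k assms(1)) auto
    also have "fgrade (\<lambda>x. - (T n ^^ (j - 1)) (p k) x + (\<Sum>i=1..n. int (exponent k j i) * \<delta> i x)) =
        fgrade (\<delta> j)"
    proof (rule fgrade_cong)
      fix x assume x: "x \<in> {1..n}"
      have "(\<Sum>i=1..n. int (exponent k j i) * \<delta> i x) = (\<Sum>i=1..n. if i = x then int (exponent k j i) else 0)"
        by (intro sum.cong) (auto simp: \<delta>_def)
      then show "- (T n ^^ (j - 1)) (p k) x + (\<Sum>i=1..n. int (exponent k j i) * \<delta> i x) = \<delta> j x"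
        using int_exponent[OF k assms(1) x] x by simp
    qed
    finally show ?thesis .
  qed
  then have "nonlinear_part (transformation H) j \<in> fgrade (\<delta> j)"
    unfolding nonlinear_part_def by (rule fgrade_sum)
  then show "fps_nth (nonlinear_part (transformation H) j) d \<in> sgrade d (\<delta> j)"
    by (simp add: fgrade_def)
next
  fix i e assume i: "i \<in> {1..n}" and e: "e \<in> {1..d-2}"
  have "H (Suc e) j \<in> sgrade (Suc e) (\<delta> j)"
    using e assms(1) by (intro H) auto
  moreover have "G (d - e) i \<in> sgrade (d - e) (\<delta> i)"
    using e i by (intro G) auto
  ultimately have "partial i (H (Suc e) j) * G (d - e) i \<in>
      sgrade (e + (d - e)) (\<lambda>x. (\<delta> j x - (if x = i then 1 else 0)) + \<delta> i x)"
    by (intro sgrade_mult sgrade_partial)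
  also have "(\<lambda>x. (\<delta> j x - (if x = i then 1 else 0)) + \<delta> i x) = \<delta> j"
    by (auto simp: \<delta>_def)
  also have "e + (d - e) = d"
    using e by auto
  finally show "partial i (H (e + 1) j) * G (d - e) i \<in> sgrade d (\<delta> j)"
    by simp
qed

text \<open>
  At resonant \<open>\<alpha>\<close> the convention \<open>inverse 0 = 0\<close> gives the choice \<open>H = 0\<close>.
\<close>
definition H_step :: "nat \<Rightarrow> state_poly \<Rightarrow> state_poly" where
  "H_step j = Poly_Mapping.mapp (\<lambda>\<alpha> x. Const (inverse (eigenvalue \<alpha> - \<zeta> ^ (j - 1))) * x)"

definition G_step :: "nat \<Rightarrow> state_poly \<Rightarrow> state_poly" where
  "G_step j = Poly_Mapping.mapp (\<lambda>\<alpha> x. Const (if eigenvalue \<alpha> = \<zeta> ^ (j - 1) then 1 else 0) * x)"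

lemma eigenvalue_in_field: "eigenvalue \<alpha> \<in> rat_adjoin \<zeta>" "\<zeta> ^ m \<in> rat_adjoin \<zeta>"
  unfolding eigenvalue_def
  by (intro rat_adjoin_sum rat_adjoin_field rat_adjoin_const rat_adjoin_power rat_adjoin_base)+

lemma step_grade:
  assumes "f \<in> sgrade d m"
  shows "H_step j f \<in> sgrade d m" and "G_step j f \<in> sgrade d m"
proof -
  show "H_step j f \<in> sgrade d m"
    unfolding H_step_def by (intro sgrade_mapp assms rat_adjoin_inverse rat_adjoin_field eigenvalue_in_field)
  show "G_step j f \<in> sgrade d m"
    unfolding G_step_def
    by (rule sgrade_mapp[OF assms, where c = "\<lambda>\<alpha>. if eigenvalue \<alpha> = \<zeta> ^ (j - 1) then 1 else 0"])
      (simp add: rat_adjoin_const)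
qed

lemma homological_equation:
  "(\<Sum>i=1..n. partial i (H_step j f) * (Const (Const (\<zeta> ^ (i - 1))) * Var i)) + G_step j f =
     Const (Const (\<zeta> ^ (j - 1))) * H_step j f + f"
proof (rule poly_mapping_eqI)
  fix \<alpha>
  let ?a = "eigenvalue \<alpha>" and ?b = "\<zeta> ^ (j - 1)" and ?x = "Poly_Mapping.lookup f \<alpha>"
  have H: "Poly_Mapping.lookup (H_step j f) \<alpha> = Const (inverse (?a - ?b)) * ?x"
    by (simp add: H_step_def lookup_mapp when_def in_keys_iff)
  have G: "Poly_Mapping.lookup (G_step j f) \<alpha> = Const (if ?a = ?b then 1 else 0) * ?x"
    by (simp add: G_step_def lookup_mapp when_def in_keys_iff)
  have "?a * inverse (?a - ?b) + (if ?a = ?b then 1 else 0) = ?b * inverse (?a - ?b) + 1"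
    by (auto simp: field_simps)
  then have "Const (?a * inverse (?a - ?b) + (if ?a = ?b then 1 else 0)) * ?x =
      Const (?b * inverse (?a - ?b) + 1) * ?x"
    by (simp only:)
  then show "Poly_Mapping.lookup ((\<Sum>i=1..n. partial i (H_step j f) *
        (Const (Const (\<zeta> ^ (i - 1))) * Var i)) + G_step j f) \<alpha> =
      Poly_Mapping.lookup (Const (Const ?b) * H_step j f + f) \<alpha>"
    unfolding lookup_add lookup_Euler lookup_Const_mult H G eigenvalue_def[symmetric]
    by (simp add: Const_add Const_mult Const_one algebra_simps)
qed

text \<open>
  The two components are \<open>H\<close> and \<open>G\<close>. The recursion is well-founded since the sequences handed to
  \<open>obstruction\<close> are cut off below \<open>d\<close>, which by \<open>obstruction_cong\<close> leaves the value unchanged.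
\<close>
fun normal_form_pair :: "nat \<Rightarrow> nat \<Rightarrow> state_poly \<times> state_poly" where
  "normal_form_pair d = (\<lambda>j.
     let N = obstruction (\<lambda>e. if e < d then fst \<circ> normal_form_pair e else (\<lambda>_. 0))
       (\<lambda>e. if e < d then snd \<circ> normal_form_pair e else (\<lambda>_. 0)) d j
     in (H_step j N, G_step j N))"

declare normal_form_pair.simps [simp del]

definition nf_H :: "nat \<Rightarrow> nat \<Rightarrow> state_poly" where "nf_H d j = fst (normal_form_pair d j)"
definition nf_G :: "nat \<Rightarrow> nat \<Rightarrow> state_poly" where "nf_G d j = snd (normal_form_pair d j)"

definition below :: "nat \<Rightarrow> (nat \<Rightarrow> nat \<Rightarrow> state_poly) \<Rightarrow> nat \<Rightarrow> nat \<Rightarrow> state_poly" where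
  "below d F = (\<lambda>e i. if e < d then F e i else 0)"

text \<open>
  The truncated form of the recursion is the one for which the induction on weights works, the
  untruncated one is the homological equation proper.
\<close>
lemma nf_step:
  "nf_H d j = H_step j (obstruction (below d nf_H) (below d nf_G) d j)"
  "nf_G d j = G_step j (obstruction (below d nf_H) (below d nf_G) d j)"
proof -
  have "(\<lambda>e. if e < d then fst \<circ> normal_form_pair e else (\<lambda>_. 0)) = below d nf_H"
    "(\<lambda>e. if e < d then snd \<circ> normal_form_pair e else (\<lambda>_. 0)) = below d nf_G"
    by (auto simp: below_def nf_H_def nf_G_def fun_eq_iff)
  then show "nf_H d j = H_step j (obstruction (below d nf_H) (below d nf_G) d j)"
    "nf_G d j = G_step j (obstruction (below d nf_H) (below d nf_G) d j)"
    unfolding nf_H_def[of d j] nf_G_def[of d j] normal_form_pair.simps[of d] by (simp_all add: Let_def)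
qed

lemma nf_recursion:
  assumes "j \<in> {1..n}"
  shows "nf_H d j = H_step j (obstruction nf_H nf_G d j)"
    and "nf_G d j = G_step j (obstruction nf_H nf_G d j)"
proof -
  have "obstruction (below d nf_H) (below d nf_G) d j = obstruction nf_H nf_G d j"
    by (rule obstruction_cong[OF assms]) (simp_all add: below_def)
  then show "nf_H d j = H_step j (obstruction nf_H nf_G d j)"
    "nf_G d j = G_step j (obstruction nf_H nf_G d j)"
    using nf_step[of d j] by simp_all
qed

lemma nf_grade:
  assumes "j \<in> {1..n}"
  shows "nf_H d j \<in> sgrade d (\<delta> j) \<and> nf_G d j \<in> sgrade d (\<delta> j)"
  using assms
proof (induction d arbitrary: j rule: less_induct)
  case (less d)
  have "obstruction (below d nf_H) (below d nf_G) d j \<in> sgrade d (\<delta> j)"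
    by (rule obstruction_grade[OF less.prems]) (use less.IH in \<open>auto simp: below_def\<close>)
  then show ?case
    unfolding nf_step[of d j] by (intro conjI step_grade)
qed

text \<open>
  In degree at least 2 the sum over \<open>e\<close> splits into the terms that involve the linear part of \<open>\<Phi>\<close>
  or of \<open>g\<close>, which make up the left-hand side of the homological equation, and the products of two
  nonlinear terms, which were moved into the obstruction. In degree 1 both sides are the linear part
  of \<open>f\<close>, as \<open>\<Phi>\<close> is tangent to the identity.
\<close>
lemma nf_conjugates: "brings_to n l \<zeta> p nf_H nf_G"
  unfolding brings_to_def
proof (intro ballI fps_ext)
  fix j d assume j: "j \<in> {1..n}"
  let ?c = "\<lambda>i. Const (Const (\<zeta> ^ (i - 1))) :: state_poly"
  let ?P = "\<lambda>i e. partial i (fps_nth (transformation nf_H j) (e + 1)) *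
    fps_nth (transformed_rhs \<zeta> nf_G i) (d - e)"
  let ?N = "fps_nth (nonlinear_part (transformation nf_H) j) d"
  have lhs: "fps_nth (\<Sum>i=1..n. partial_fps i (transformation nf_H j) * transformed_rhs \<zeta> nf_G i) d =
      (\<Sum>i=1..n. \<Sum>e=0..d. ?P i e)"
    by (simp add: fps_sum_nth fps_mult_nth partial_fps_def)
  have rhs: "fps_nth (subst n (transformation nf_H) (system_rhs n l \<zeta> p j)) d =
      ?c j * fps_nth (transformation nf_H j) d + ?N"
    by (simp add: subst_system[OF j])
  have "(\<Sum>i=1..n. \<Sum>e=0..d. ?P i e) = ?c j * fps_nth (transformation nf_H j) d + ?N"
  proof -
    consider "d = 0" | "d = 1" | "d \<ge> 2" by linarith
    then show ?thesis
    proof cases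
      case 1
      then show ?thesis
        using nonlinear_part_low[OF j, of 0] by (simp add: transformation_nth transformed_rhs_nth)
    next
      case 2
      then have "(\<Sum>i=1..n. \<Sum>e=0..d. ?P i e) = (\<Sum>i=1..n. if i = j then ?c i * Var i else 0)"
        by (intro sum.cong) (auto simp: transformation_nth transformed_rhs_nth partial_Var)
      with 2 j show ?thesis
        using nonlinear_part_low[OF j, of 1] by (simp add: transformation_nth)
    next
      case 3
      have split: "(\<Sum>e=0..d. ?P i e) = (if i = j then nf_G d i else 0) +
          (\<Sum>e=1..d-2. partial i (nf_H (e + 1) j) * nf_G (d - e) i) +
          partial i (nf_H d j) * (?c i * Var i)" for i
      proof -
        have "{0..d} = insert 0 (insert d (insert (d - 1) {1..d-2}))"
          using 3 by auto
        moreover have "0 \<notin> insert d (insert (d - 1) {1..d-2})" "d \<notin> insert (d - 1) {1..d-2}"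
          "d - 1 \<notin> {1..d-2}"
          using 3 by auto
        ultimately have "(\<Sum>e=0..d. ?P i e) = ?P i 0 + (?P i d + (?P i (d - 1) + (\<Sum>e=1..d-2. ?P i e)))"
          by (simp only: sum.insert finite_insert finite_atLeastAtMost not_False_eq_True)
        moreover have "?P i 0 = (if i = j then nf_G d i else 0)"
          using 3 by (simp add: transformation_nth transformed_rhs_nth partial_Var)
        moreover have "?P i d = 0"
          by (simp add: transformed_rhs_nth)
        moreover have "?P i (d - 1) = partial i (nf_H d j) * (?c i * Var i)"
          using 3 by (simp add: transformation_nth transformed_rhs_nth)
        moreover have "(\<Sum>e=1..d-2. ?P i e) =
            (\<Sum>e=1..d-2. partial i (nf_H (e + 1) j) * nf_G (d - e) i)"
          using 3 by (intro sum.cong) (auto simp: transformation_nth transformed_rhs_nth)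
        ultimately show ?thesis by simp
      qed
      have "(\<Sum>i=1..n. \<Sum>e=0..d. ?P i e) = nf_G d j +
          (\<Sum>i=1..n. \<Sum>e=1..d-2. partial i (nf_H (e + 1) j) * nf_G (d - e) i) +
          (\<Sum>i=1..n. partial i (nf_H d j) * (?c i * Var i))"
        unfolding split sum.distrib using j by simp
      also have "\<dots> = ?c j * nf_H d j + ?N"
        using homological_equation[of j "obstruction nf_H nf_G d j"]
        unfolding nf_recursion[OF j, symmetric]
        by (simp add: obstruction_def algebra_simps)
      finally show ?thesis
        using 3 by (simp add: transformation_nth)
    qed
  qed
  then show "fps_nth (\<Sum>i=1..n. partial_fps i (transformation nf_H j) * transformed_rhs \<zeta> nf_G i) d =
      fps_nth (subst n (transformation nf_H) (system_rhs n l \<zeta> p j)) d"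
    unfolding lhs rhs .
qed

lemma nf_G_resonant:
  assumes "j \<in> {1..n}" and "\<alpha> \<in> Poly_Mapping.keys (nf_G d j)"
  shows "eigenvalue \<alpha> = \<zeta> ^ (j - 1)"
proof (rule ccontr)
  assume "eigenvalue \<alpha> \<noteq> \<zeta> ^ (j - 1)"
  with assms show False
    by (simp add: nf_recursion in_keys_iff G_step_def lookup_mapp when_def Const_zero split: if_splits)
qed

lemma nf_poincare_dulac: "poincare_dulac_normal_form n l \<zeta> p nf_H nf_G"
  unfolding poincare_dulac_normal_form_def
proof (intro conjI allI impI ballI)
  fix d i assume "i \<in> {1..n}"
  then show "homogeneous n l d (nf_H d i)" "homogeneous n l d (nf_G d i)"
    using nf_grade sgrade_homogeneous by blast+
next
  fix d k \<alpha> assume "k \<in> {1..n}" and "\<alpha> \<in> Poly_Mapping.keys (nf_G d k)"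
  then show "(\<Sum>i=1..n. of_nat (Poly_Mapping.lookup \<alpha> i) * \<zeta> ^ (i - 1)) - \<zeta> ^ (k - 1) = 0"
    using nf_G_resonant by (simp add: eigenvalue_def)
qed (rule nf_conjugates)

section \<open>The resonant terms\<close>

text \<open>The exponent of \<open>(y\<^sub>1 \<cdots> y\<^sub>n)^K y\<^sub>j\<close>.\<close>
definition diag_exp :: "nat \<Rightarrow> nat \<Rightarrow> nat \<Rightarrow>\<^sub>0 nat" where
  "diag_exp K j = (\<Sum>i=1..n. Poly_Mapping.single i (K + (if i = j then 1 else 0)))"

lemma lookup_diag_exp:
  "Poly_Mapping.lookup (diag_exp K j) i = (if i \<in> {1..n} then K + (if i = j then 1 else 0) else 0)"
  unfolding diag_exp_def by (rule lookup_sum_single) simp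

lemma single_diag_exp:
  fixes q :: param_poly
  assumes "j \<in> {1..n}"
  shows "Poly_Mapping.single (diag_exp K j) q = (\<Prod>m=1..n. Var m) ^ K * (Const q * Var j)"
proof -
  have "(\<Prod>i=1..n. Var i ^ (if i = j then 1 else 0)) = (Var j :: state_poly)"
    using assms by (simp add: if_distrib[of "\<lambda>e. _ ^ e"] cong: if_cong)
  then have "(\<Prod>m=1..n. Var m) ^ K * (Const q * Var j) =
      Const q * ((\<Prod>i=1..n. Var i ^ K) * (\<Prod>i=1..n. Var i ^ (if i = j then 1 else 0)))"
    by (simp only: prod_power_distrib ac_simps)
  also have "\<dots> = Const q * (\<Prod>i=1..n. Var i ^ (K + (if i = j then 1 else 0)))"
    by (simp only: power_add prod.distrib)
  finally have "(\<Prod>m=1..n. Var m) ^ K * (Const q * Var j) =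
      Const q * (\<Prod>i=1..n. Var i ^ (K + (if i = j then 1 else 0)))" .
  then show ?thesis
    by (simp only: prod_Var_power Const_mult_single diag_exp_def mult_1_right)
qed

text \<open>
  The degree of a resonant monomial is \<open>nK + 1\<close>; so in each degree \<open>d\<close> at most the value
  \<open>K = (d - 1) div n\<close> is possible, in degrees of another form the coefficient is zero.
\<close>
lemma nf_G_shape:
  fixes d :: nat
  assumes "j \<in> {1..n}"
  defines "K \<equiv> (d - 1) div n"
  shows "nf_G d j = (\<Prod>m=1..n. Var m) ^ K *
    (Const (Poly_Mapping.lookup (nf_G d j) (diag_exp K j)) * Var j)"
proof -
  have keys: "\<alpha> = diag_exp K j" if \<alpha>: "\<alpha> \<in> Poly_Mapping.keys (nf_G d j)" for \<alpha>
  proof -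
    obtain c where c: "\<And>i. i \<in> {1..n} \<Longrightarrow> Poly_Mapping.lookup \<alpha> i = c + (if i = j then 1 else 0)"
      using resonance[OF nf_G_resonant[OF assms(1) \<alpha>] assms(1)] by blast
    note grade = sgrade_keysD[OF conjunct2[OF nf_grade[OF assms(1)]] \<alpha>]
    have "d = (\<Sum>i=1..n. c + (if i = j then 1 else 0))"
      using grade(2) c by simp
    also have "\<dots> = n * c + 1"
      using assms(1) by (simp add: sum.distrib)
    finally have "K = c" using n_gt_2 by (simp add: K_def)
    show ?thesis
    proof (rule poly_mapping_eqI)
      fix i
      show "Poly_Mapping.lookup \<alpha> i = Poly_Mapping.lookup (diag_exp K j) i"
      proof (cases "i \<in> {1..n}")
        case True
        then show ?thesis by (simp add: lookup_diag_exp c \<open>K = c\<close>)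
      next
        case False
        then have "i \<notin> Poly_Mapping.keys \<alpha>" using grade(1) by blast
        then have "Poly_Mapping.lookup \<alpha> i = 0" by (simp add: in_keys_iff)
        with False show ?thesis by (simp only: lookup_diag_exp if_False)
      qed
    qed
  qed
  have "nf_G d j = Poly_Mapping.single (diag_exp K j) (Poly_Mapping.lookup (nf_G d j) (diag_exp K j))"
    by (rule poly_mapping_eqI) (use keys in \<open>auto simp: lookup_single when_def in_keys_iff\<close>)
  then show ?thesis
    by (simp only: single_diag_exp[OF assms(1), symmetric])
qed

lemma nf_G_coeff_grade:
  assumes "j \<in> {1..n}"
  shows "Poly_Mapping.lookup (nf_G d j) (diag_exp K j) \<in> pgrade (\<lambda>_. int K)"
proof (cases "Poly_Mapping.lookup (nf_G d j) (diag_exp K j) = 0")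
  case False
  then have "Poly_Mapping.lookup (nf_G d j) (diag_exp K j) \<in>
      pgrade (\<lambda>i. int (Poly_Mapping.lookup (diag_exp K j) i) - \<delta> j i)"
    using nf_grade[OF assms] by (intro sgrade_keysD(3)) (auto simp: in_keys_iff)
  also have "pgrade (\<lambda>i. int (Poly_Mapping.lookup (diag_exp K j) i) - \<delta> j i) = pgrade (\<lambda>_. int K)"
    by (rule pgrade_cong) (auto simp: lookup_diag_exp \<delta>_def)
  finally show ?thesis .
qed simp

end

lemma param_monom_eq_single:
  assumes "\<nu> \<in> param_exps n l"
  shows "param_monom n l \<nu> = Poly_Mapping.single \<nu> 1"
proof -
  have "param_monom n l \<nu> = (\<Prod>(k, m)\<in>{1..l} \<times> {..<n}. Var (k, m + 1) ^ Poly_Mapping.lookup \<nu> (k, m + 1))"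
    unfolding param_monom_def by (simp add: prod.cartesian_product)
  also have "\<dots> = (\<Prod>v\<in>{1..l} \<times> {1..n}. Var v ^ Poly_Mapping.lookup \<nu> v)"
    by (rule prod.reindex_bij_witness[of _ "\<lambda>(k, j). (k, j - 1)" "\<lambda>(k, m). (k, m + 1)"]) auto
  also have "(\<Sum>v\<in>{1..l} \<times> {1..n}. Poly_Mapping.single v (Poly_Mapping.lookup \<nu> v)) = \<nu>"
  proof (rule poly_mapping_eqI)
    fix v
    have "Poly_Mapping.lookup \<nu> v = 0" if "v \<notin> {1..l} \<times> {1..n}"
      using that assms by (auto simp: param_exps_def in_keys_iff)
    then show "Poly_Mapping.lookup (\<Sum>v\<in>{1..l} \<times> {1..n}. Poly_Mapping.single v (Poly_Mapping.lookup \<nu> v)) v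
        = Poly_Mapping.lookup \<nu> v"
      by (subst lookup_sum_single) auto
  qed
  then have "(\<Prod>v\<in>{1..l} \<times> {1..n}. Var v ^ Poly_Mapping.lookup \<nu> v) = Poly_Mapping.single \<nu> 1"
    by (simp only: prod_Var_power)
  finally show ?thesis .
qed

text \<open>
  Even the linear span of the generators suffices: an element of weight \<open>(K,\<dots>,K)\<close> is a
  linear combination of monomials \<open>[\<nu>]\<close> with \<open>\<nu> \<in> M\<close>.
\<close>
lemma (in cyclic_grading) diagonal_grade_in_subalgebra:
  assumes "f \<in> pgrade (\<lambda>_. int K)"
  shows "f \<in> subalgebra_gen (rat_adjoin \<zeta>) (param_monom n l ` M n l p)" (is "_ \<in> ?A")
proof -
  have zero: "0 \<in> ?A"
    using subalgebra_gen.scalar[OF rat_adjoin_const(1)] by (simp add: Const_zero)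
  have sum: "(\<Sum>i\<in>I. g i) \<in> ?A" if "\<And>i. i \<in> I \<Longrightarrow> g i \<in> ?A" for I :: "param_exp set" and g
    using that by (induction I rule: infinite_finite_induct) (auto simp: zero intro: subalgebra_gen.plus)
  have "Poly_Mapping.single \<nu> (Poly_Mapping.lookup f \<nu>) \<in> ?A" if "\<nu> \<in> Poly_Mapping.keys f" for \<nu>
  proof -
    have \<nu>: "\<nu> \<in> param_exps n l" "\<forall>i\<in>{1..n}. L n l p \<nu> i = int K" "Poly_Mapping.lookup f \<nu> \<in> rat_adjoin \<zeta>"
      using assms that by (auto simp: R_def)
    then have "\<nu> \<in> M n l p" by (auto simp: M_def)
    then have "Const (Poly_Mapping.lookup f \<nu>) * param_monom n l \<nu> \<in> ?A"
      using \<nu>(3) by (intro subalgebra_gen.times subalgebra_gen.scalar subalgebra_gen.gen) auto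
    then show ?thesis
      by (simp add: param_monom_eq_single[OF \<nu>(1)] Const_mult_single)
  qed
  then have "(\<Sum>\<nu>\<in>Poly_Mapping.keys f. Poly_Mapping.single \<nu> (Poly_Mapping.lookup f \<nu>)) \<in> ?A"
    by (rule sum)
  then show ?thesis by (simp only: sum_singles)
qed

theorem corollary4p10:
  fixes n l :: nat and \<zeta> :: complex and p :: "nat \<Rightarrow> nat \<Rightarrow> int"
  assumes "prime n" and "n > 2"
    and "primitive_root_of_unity n \<zeta>"
    and "l \<ge> 1"
    and "\<forall>k\<in>{1..l}. p k 1 \<ge> -1 \<and> (\<forall>i\<in>{2..n}. p k i \<ge> 0) \<and> (\<Sum>i=1..n. p k i) \<ge> 1"
    and "\<forall>k\<in>{1..l}. \<forall>k'\<in>{1..l}. k \<noteq> k' \<longrightarrow> (\<exists>i\<in>{1..n}. p k i \<noteq> p k' i)"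
  shows "\<exists>H G. poincare_dulac_normal_form n l \<zeta> p H G \<and>
    (\<forall>j\<ge>2. \<exists>(K::nat) q. \<forall>i\<in>{1..n}.
       G j i = (\<Prod>m=1..n. Var m) ^ K * (Const (q i) * Var i) \<and>
       q i \<in> R (rat_adjoin \<zeta>) n l p (\<lambda>_. int K) \<and>
       q i \<in> subalgebra_gen (rat_adjoin \<zeta>) (param_monom n l ` M n l p))"
proof -
  interpret cyclic_system n l \<zeta> p
    using assms by unfold_locales auto
  show ?thesis
  proof (intro exI conjI allI impI ballI)
    show "poincare_dulac_normal_form n l \<zeta> p nf_H nf_G"
      by (rule nf_poincare_dulac)
    fix d i :: nat assume i: "i \<in> {1..n}"
    then show "nf_G d i = (\<Prod>m=1..n. Var m) ^ ((d - 1) div n) *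
        (Const (Poly_Mapping.lookup (nf_G d i) (diag_exp ((d - 1) div n) i)) * Var i)"
      by (intro nf_G_shape)
    show "Poly_Mapping.lookup (nf_G d i) (diag_exp ((d - 1) div n) i) \<in>
        R (rat_adjoin \<zeta>) n l p (\<lambda>_. int ((d - 1) div n))"
      using i by (rule nf_G_coeff_grade)
    then show "Poly_Mapping.lookup (nf_G d i) (diag_exp ((d - 1) div n) i) \<in>
        subalgebra_gen (rat_adjoin \<zeta>) (param_monom n l ` M n l p)"
      by (rule diagonal_grade_in_subalgebra)
  qed
qed

end
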